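(* Let $v\in H^2_{\rm iso}(S;\mathbb R^3)$. Then (for a.e. $s\in S$) $$Q^\gamma_{\rm hom}\bigl(s,\mathrm{II}_v-B^\gamma_{\rm eff}(s)\bigr)=\mathbf Q^\gamma_{\rm hom}\bigl(s,\nabla^2v+n_v\otimes B^\gamma_{\rm eff}(s)\bigr)=\mathbf Q^\gamma_{\rm hom}\bigl(s,\nabla^2v\bigr)+2\bigl\langle\boldsymbol L^\gamma_{\rm hom}(s)\nabla^2v,\ n_v\otimes B^\gamma_{\rm eff}(s)\bigr\rangle+Q^\gamma_{\rm hom}\bigl(s,B^\gamma_{\rm eff}(s)\bigr).$$
   Context: $S\subset\mathbb R^2$ is an open, bounded, connected Lipschitz domain. $H^2_{\rm iso}(S;\mathbb R^3)=\{v\in H^2(S;\mathbb R^3):(\nabla v)^\top\nabla v=I_{2\times2}\text{ a.e.}\}$. For $v\in H^2_{\rm iso}$: $n_v=\partial_1v\times\partial_2v$, $\mathrm{II}_v$ is the second fundamental form $(\mathrm{II}_v)_{jk}=\partial_jv\cdot\partial_kn_v$, and $(\nabla^2v)_{ijk}=\partial_j\partial_kv_i$. For $a\in\mathbb R^3$, $A\in\mathbb R^{2\times2}$, $\mathbf A\in\mathbb R^{3\times2\times2}$: $(a\otimes A)_{ijk}=a_iA_{jk}$, $(a\cdot\mathbf A)_{jk}=\sum_ia_i\mathbf A_{ijk}$. $\langle\cdot,\cdot\rangle$, $|\cdot|$ are the Frobenius inner product and norm. Effective quantities. Let $\gamma\in(0,\infty)$, $\Box=(0,1)^2\times(-\frac12,\frac12)$,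 and let $\mathbb L:S\times\Box\to\operatorname{Lin}(\mathbb R^{3\times3};\mathbb R^{3\times3})$, $B:S\times\Box\to\mathbb R^{3\times3}$ be measurable with $\langle\mathbb L(s,y)G,F\rangle=\langle\mathbb L(s,y)F,G\rangle=\langle\mathbb L(s,y)\operatorname{sym}F,\operatorname{sym}G\rangle$, $\langle\mathbb L(s,y)F,G\rangle\le c_0|\operatorname{sym}F||\operatorname{sym}G|$, $\langle\mathbb L(s,y)G,G\rangle\ge\frac1{c_0}|\operatorname{sym}G|^2$ and $\int_\Box|B(s,y)|^2dy\le c_0$ for some $c_0>0$. Let $\iota(G)=\sum_{i,j=1}^2G_{ij}e_i\otimes e_j\in\mathbb R^{3\times3}$ for $G\in\mathbb R^{2\times2}$, $\nabla_\gamma\varphi=(\partial_{y_1}\varphi,\partial_{y_2}\varphi,\frac1\gamma\partial_{y_3}\varphi)$, $H^1_{\rm per}(\Box;\mathbb R^3)$ the zero-mean functions in $H^1(\Box;\mathbb R^3)$ that are 1-periodic in $y_1,y_2$, and $\mathcal V=\{\iota(M)y+\varphi:M\in\mathbb R^{2\times2}_{\rm sym},\varphi\in H^1_{\rm per}(\Box;\mathbb R^3)\}$. Let $G_1,G_2,G_3$ be an orthonormal basis of $\mathbb R^{2\times2}_{\rm sym}$, $\widehat A_i$ the coefficients of $A$ in this basis, and $\vartheta_i(s)\in\mathcal V$ the unique solution of $\int_\Box\langle\mathbb L(s,y)(\iota(y_3G_i)+\nabla_\gamma\vartheta_i(s)),\nabla_\gamma w\rangle dy=0$ for all $w\in\mathcal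 V$. Set $\widehat Q_{ij}(s)=\int_\Box\langle\mathbb L(s,y)(\iota(y_3G_i)+\nabla_\gamma\vartheta_i),\iota(y_3G_j)+\nabla_\gamma\vartheta_j\rangle dy$ (a positive definite matrix), $Q^\gamma_{\rm hom}(s,G)=\sum_{i,j}\widehat Q_{ij}(s)\widehat{(\operatorname{sym}G)}_i\widehat{(\operatorname{sym}G)}_j$ for $G\in\mathbb R^{2\times2}$, $\widehat B_i(s)=\int_\Box\langle\mathbb L(s,y)(\iota(y_3G_i)+\nabla_\gamma\vartheta_i),B(s,y)\rangle dy$, and $B^\gamma_{\rm eff}(s)=\sum_i\widehat B_{{\rm eff},i}(s)G_i\in\mathbb R^{2\times2}_{\rm sym}$, where $\widehat Q(s)\widehat B_{\rm eff}(s)=\widehat B(s)$. Third-order versions. For $\mathbf A\in\mathbb R^{3\times2\times2}$, $\mathbf Q^\gamma_{\rm hom}(s,\mathbf A)=\sum_{i=1}^3Q^\gamma_{\rm hom}(s,e_i\cdot\mathbf A)$, and $\boldsymbol L^\gamma_{\rm hom}(s)$ is defined by $\langle\boldsymbol L^\gamma_{\rm hom}(s)\mathbf F,\mathbf G\rangle=\frac12(\mathbf Q^\gamma_{\rm hom}(s,\mathbf F+\mathbf G)-\mathbf Q^\gamma_{\rm hom}(s,\mathbf F)-\mathbf Q^\gamma_{\rm hom}(s,\mathbf G))$ for all $\mathbf F,\mathbf G\in\mathbb R^{3\times2\times2}$. *)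

theory Defs
  imports "HOL-Analysis.Analysis"
begin

text \<open>Matrices and third-order tensors are nested vectors: \<open>F $ i $ j\<close> is the entry in row \<open>i\<close>,
  column \<open>j\<close> of a matrix \<open>F\<close>, and \<open>real^2^2^3\<close> consists of the tensors \<open>A $ i $ j $ k\<close> with
  \<open>i\<close> ranging over \<open>3\<close> and \<open>j\<close>, \<open>k\<close> over \<open>2\<close>.  On these types the library's inner product
  and norm are the Frobenius ones.\<close>

subsection \<open>Lipschitz domains\<close>

definition lipschitz_boundary :: "(real^2) set \<Rightarrow> bool" where
  "lipschitz_boundary S \<longleftrightarrow>
     (\<forall>p\<in>frontier S. \<exists>U (R :: real^2 \<Rightarrow> real^2) (h :: real \<Rightarrow> real) C.
        open U \<and> p \<in> U \<and> orthogonal_transformation R \<and> C-lipschitz_on UNIV h \<and>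
        S \<inter> U = {x \<in> U. h (R x $ 1) < R x $ 2})"

subsection \<open>Weak derivatives and Sobolev spaces\<close>

definition pd :: "'n::finite \<Rightarrow> (real^'n \<Rightarrow> real) \<Rightarrow> real^'n \<Rightarrow> real" where
  "pd j f x = frechet_derivative f (at x) (axis j 1)"

primrec C_k :: "nat \<Rightarrow> (real^'n::finite \<Rightarrow> real) \<Rightarrow> bool" where
  "C_k 0 f \<longleftrightarrow> continuous_on UNIV f"
| "C_k (Suc k) f \<longleftrightarrow> (\<forall>x. f differentiable (at x)) \<and> (\<forall>j. C_k k (pd j f))"

definition test_function :: "(real^'n::finite) set \<Rightarrow> (real^'n \<Rightarrow> real) \<Rightarrow> bool" where
  "test_function S \<phi> \<longleftrightarrow> (\<forall>k. C_k k \<phi>) \<and>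
     compact (closure {x. \<phi> x \<noteq> 0}) \<and> closure {x. \<phi> x \<noteq> 0} \<subseteq> S"

definition locally_integrable ::
    "(real^'n::finite) set \<Rightarrow> (real^'n \<Rightarrow> 'b::euclidean_space) \<Rightarrow> bool" where
  "locally_integrable S f \<longleftrightarrow> (\<forall>K. compact K \<and> K \<subseteq> S \<longrightarrow> f absolutely_integrable_on K)"

definition has_weak_pd ::
    "(real^'n::finite) set \<Rightarrow> 'n \<Rightarrow> (real^'n \<Rightarrow> 'b::euclidean_space) \<Rightarrow> (real^'n \<Rightarrow> 'b) \<Rightarrow> bool" where
  "has_weak_pd S j f g \<longleftrightarrow> locally_integrable S f \<and> locally_integrable S g \<and>
     (\<forall>\<phi>. test_function S \<phi> \<longrightarrow>
        (LINT x:S|lebesgue. pd j \<phi> x *\<^sub>R f x) = - (LINT x:S|lebesgue. \<phi> x *\<^sub>R g x))"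

text \<open>A representative of the weak partial derivative, which is unique up to null sets.\<close>

definition weak_pd ::
    "(real^'n::finite) set \<Rightarrow> 'n \<Rightarrow> (real^'n \<Rightarrow> 'b::euclidean_space) \<Rightarrow> real^'n \<Rightarrow> 'b" where
  "weak_pd S j f = (SOME g. has_weak_pd S j f g)"

definition L2 :: "(real^'n::finite) set \<Rightarrow> (real^'n \<Rightarrow> 'b::euclidean_space) \<Rightarrow> bool" where
  "L2 S f \<longleftrightarrow> f \<in> borel_measurable (lebesgue_on S) \<and> integrable (lebesgue_on S) (\<lambda>x. (norm (f x))\<^sup>2)"

definition H1 :: "(real^'n::finite) set \<Rightarrow> (real^'n \<Rightarrow> 'b::euclidean_space) \<Rightarrow> bool" where
  "H1 S f \<longleftrightarrow> L2 S f \<and> (\<forall>j. \<exists>g. has_weak_pd S j f g \<and> L2 S g)"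

definition H2 :: "(real^'n::finite) set \<Rightarrow> (real^'n \<Rightarrow> 'b::euclidean_space) \<Rightarrow> bool" where
  "H2 S f \<longleftrightarrow> H1 S f \<and> (\<forall>j. H1 S (weak_pd S j f))"

subsection \<open>Isometric immersions\<close>

definition grad :: "(real^2) set \<Rightarrow> (real^2 \<Rightarrow> real^3) \<Rightarrow> real^2 \<Rightarrow> real^2^3" where
  "grad S v x = (\<chi> i j. weak_pd S j v x $ i)"

definition hess :: "(real^2) set \<Rightarrow> (real^2 \<Rightarrow> real^3) \<Rightarrow> real^2 \<Rightarrow> real^2^2^3" where
  "hess S v x = (\<chi> i j k. weak_pd S j (weak_pd S k v) x $ i)"

definition H2_iso :: "(real^2) set \<Rightarrow> (real^2 \<Rightarrow> real^3) \<Rightarrow> bool" where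
  "H2_iso S v \<longleftrightarrow> H2 S v \<and>
     (AE x in lebesgue_on S. transpose (grad S v x) ** grad S v x = mat 1)"

definition normal :: "(real^2) set \<Rightarrow> (real^2 \<Rightarrow> real^3) \<Rightarrow> real^2 \<Rightarrow> real^3" where
  "normal S v x = cross3 (weak_pd S 1 v x) (weak_pd S 2 v x)"

definition II :: "(real^2) set \<Rightarrow> (real^2 \<Rightarrow> real^3) \<Rightarrow> real^2 \<Rightarrow> real^2^2" where
  "II S v x = (\<chi> j k. weak_pd S j v x \<bullet> weak_pd S k (normal S v) x)"

subsection \<open>Tensor algebra\<close>

definition sym_part :: "real^'n^'n \<Rightarrow> real^'n^'n" where
  "sym_part F = (1/2) *\<^sub>R (F + transpose F)"

definition iota :: "real^2^2 \<Rightarrow> real^3^3" where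
  "iota G = vector [vector [G$1$1, G$1$2, 0], vector [G$2$1, G$2$2, 0], 0]"

definition tensor :: "real^3 \<Rightarrow> real^2^2 \<Rightarrow> real^2^2^3" where
  "tensor a A = (\<chi> i j k. a $ i * A $ j $ k)"

definition contract :: "real^3 \<Rightarrow> real^2^2^3 \<Rightarrow> real^2^2" where
  "contract a A = (\<chi> j k. \<Sum>i\<in>UNIV. a $ i * A $ i $ j $ k)"

definition orthonormal_basis_sym :: "(3 \<Rightarrow> real^2^2) \<Rightarrow> bool" where
  "orthonormal_basis_sym G \<longleftrightarrow>
     (\<forall>i j. G i \<bullet> G j = (if i = j then 1 else 0)) \<and> span (range G) = {A. transpose A = A}"

text \<open>The coefficients of \<open>A\<close> with respect to the orthonormal basis \<open>G\<close>.\<close>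

definition coeffs_in :: "(3 \<Rightarrow> real^2^2) \<Rightarrow> real^2^2 \<Rightarrow> real^3" where
  "coeffs_in G A = (\<chi> i. A \<bullet> G i)"

subsection \<open>The cell problem\<close>

definition Cell :: "(real^3) set" where
  "Cell = {y. 0 < y$1 \<and> y$1 < 1 \<and> 0 < y$2 \<and> y$2 < 1 \<and> -1/2 < y$3 \<and> y$3 < 1/2}"

definition Slab :: "(real^3) set" where
  "Slab = {y. -1/2 < y$3 \<and> y$3 < 1/2}"

text \<open>A periodic element of \<open>H1 Cell\<close> is one whose periodic function on the slab \<open>\<real>\<^sup>2 \<times> (-1/2, 1/2)\<close>
  is weakly differentiable across the lateral cell faces, i.e. whose traces on opposite faces agree.\<close>

definition H1_per :: "(real^3 \<Rightarrow> real^3) \<Rightarrow> bool" where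
  "H1_per \<phi> \<longleftrightarrow> H1 Cell \<phi> \<and>
     (\<forall>y\<in>Slab. \<phi> (y + axis 1 1) = \<phi> y \<and> \<phi> (y + axis 2 1) = \<phi> y) \<and>
     (\<forall>j. \<exists>g. has_weak_pd Slab j \<phi> g) \<and>
     (LINT y:Cell|lebesgue. \<phi> y) = 0"

definition \<V> :: "(real^3 \<Rightarrow> real^3) set" where
  "\<V> = {(\<lambda>y. iota M *v y + \<phi> y) | M \<phi>. transpose M = M \<and> H1_per \<phi>}"

definition grad_scaled :: "real \<Rightarrow> (real^3 \<Rightarrow> real^3) \<Rightarrow> real^3 \<Rightarrow> real^3^3" where
  "grad_scaled \<gamma> w y = (\<chi> i j. (if j = 3 then 1/\<gamma> else 1) * weak_pd Cell j w y $ i)"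

type_synonym elasticity = "(real^2) \<times> (real^3) \<Rightarrow> ((real^3^3) \<Rightarrow>\<^sub>L (real^3^3))"

definition is_corrector ::
    "real \<Rightarrow> elasticity \<Rightarrow> real^2 \<Rightarrow> real^2^2 \<Rightarrow> (real^3 \<Rightarrow> real^3) \<Rightarrow> bool" where
  "is_corrector \<gamma> LL s G \<theta> \<longleftrightarrow> \<theta> \<in> \<V> \<and>
     (\<forall>w\<in>\<V>. (LINT y:Cell|lebesgue.
        blinfun_apply (LL (s, y)) (iota (y$3 *\<^sub>R G) + grad_scaled \<gamma> \<theta> y) \<bullet> grad_scaled \<gamma> w y) = 0)"

text \<open>Elements of \<open>\<V>\<close> are functions rather than equivalence classes, so the corrector is unique
  only up to null sets; the integrals below do not depend on the representative.\<close>

definition corrector :: "real \<Rightarrow> elasticity \<Rightarrow> real^2 \<Rightarrow> real^2^2 \<Rightarrow> real^3 \<Rightarrow> real^3" where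
  "corrector \<gamma> LL s G = (SOME \<theta>. is_corrector \<gamma> LL s G \<theta>)"

definition cell_strain :: "real \<Rightarrow> elasticity \<Rightarrow> real^2 \<Rightarrow> real^2^2 \<Rightarrow> real^3 \<Rightarrow> real^3^3" where
  "cell_strain \<gamma> LL s G y = iota (y$3 *\<^sub>R G) + grad_scaled \<gamma> (corrector \<gamma> LL s G) y"

subsection \<open>Effective quantities\<close>

definition Q_hat :: "real \<Rightarrow> elasticity \<Rightarrow> (3 \<Rightarrow> real^2^2) \<Rightarrow> real^2 \<Rightarrow> real^3^3" where
  "Q_hat \<gamma> LL G s = (\<chi> i j. LINT y:Cell|lebesgue.
     blinfun_apply (LL (s, y)) (cell_strain \<gamma> LL s (G i) y) \<bullet> cell_strain \<gamma> LL s (G j) y)"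

definition Q_hom :: "real \<Rightarrow> elasticity \<Rightarrow> (3 \<Rightarrow> real^2^2) \<Rightarrow> real^2 \<Rightarrow> real^2^2 \<Rightarrow> real" where
  "Q_hom \<gamma> LL G s A = (\<Sum>i\<in>UNIV. \<Sum>j\<in>UNIV. Q_hat \<gamma> LL G s $ i $ j *
     coeffs_in G (sym_part A) $ i * coeffs_in G (sym_part A) $ j)"

definition B_hat ::
    "real \<Rightarrow> elasticity \<Rightarrow> ((real^2) \<times> (real^3) \<Rightarrow> real^3^3) \<Rightarrow> (3 \<Rightarrow> real^2^2) \<Rightarrow> real^2 \<Rightarrow> real^3" where
  "B_hat \<gamma> LL B G s = (\<chi> i. LINT y:Cell|lebesgue.
     blinfun_apply (LL (s, y)) (cell_strain \<gamma> LL s (G i) y) \<bullet> B (s, y))"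

definition B_eff_hat ::
    "real \<Rightarrow> elasticity \<Rightarrow> ((real^2) \<times> (real^3) \<Rightarrow> real^3^3) \<Rightarrow> (3 \<Rightarrow> real^2^2) \<Rightarrow> real^2 \<Rightarrow> real^3" where
  "B_eff_hat \<gamma> LL B G s = (THE b. Q_hat \<gamma> LL G s *v b = B_hat \<gamma> LL B G s)"

definition B_eff ::
    "real \<Rightarrow> elasticity \<Rightarrow> ((real^2) \<times> (real^3) \<Rightarrow> real^3^3) \<Rightarrow> (3 \<Rightarrow> real^2^2) \<Rightarrow> real^2 \<Rightarrow> real^2^2" where
  "B_eff \<gamma> LL B G s = (\<Sum>i\<in>UNIV. B_eff_hat \<gamma> LL B G s $ i *\<^sub>R G i)"

definition Q3_hom :: "real \<Rightarrow> elasticity \<Rightarrow> (3 \<Rightarrow> real^2^2) \<Rightarrow> real^2 \<Rightarrow> real^2^2^3 \<Rightarrow> real" where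
  "Q3_hom \<gamma> LL G s A = (\<Sum>i\<in>UNIV. Q_hom \<gamma> LL G s (contract (axis i 1) A))"

definition L3_hom :: "real \<Rightarrow> elasticity \<Rightarrow> (3 \<Rightarrow> real^2^2) \<Rightarrow> real^2 \<Rightarrow> real^2^2^3 \<Rightarrow> real^2^2^3" where
  "L3_hom \<gamma> LL G s = (THE L. \<forall>E F. L E \<bullet> F =
     1/2 * (Q3_hom \<gamma> LL G s (E + F) - Q3_hom \<gamma> LL G s E - Q3_hom \<gamma> LL G s F))"

end

theory Submission
  imports Defs
begin

text \<open>The fundamental lemma and the product rule share one device. The integral of a product
  is the value at \<open>z = 0\<close> of the correlation \<open>corr a b z\<close>, the integral of
  a(x) b(x + z) over x. It is continuous at 0 because translations are continuous in L1, and
  integrating it against smooth bumps in \<open>z\<close> turns, by Fubini, into weak equations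
  tested with translated bumps. The isometry constraint is used twice: it makes the first
  derivatives of \<open>v\<close> orthonormal, and it bounds them, so that products of a first with
  a second derivative are locally integrable and the product rule applies. That rule also shows that
  \<open>normal S v\<close> is weakly differentiable at all; only then does the choice
  \<open>weak_pd S k (normal S v)\<close> inside \<open>II\<close> have a meaning. The transpose
  comes from the index conventions: \<open>II\<close> differentiates the normal in its second index,
  so its entry (j, k) is computed from the weak derivative in direction k of the j-th one, while
  \<open>hess\<close> has the opposite order.\<close>

text \<open>Everything rests on the pointwise identity \<open>\<nabla>\<^sup>2v = - n \<otimes> II\<^sup>T\<close>.  Differentiating
  \<open>\<partial>\<^sub>kv \<bullet> \<partial>\<^sub>lv = \<delta>\<^sub>k\<^sub>l\<close> shows that \<open>\<Gamma>\<^sub>j\<^sub>k\<^sub>l = \<partial>\<^sub>j\<partial>\<^sub>kv \<bullet> \<partial>\<^sub>lv\<close> is antisymmetric in \<open>k, l\<close>; it is symmetric in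
  \<open>j, k\<close>, hence it vanishes and second derivatives of \<open>v\<close> are normal, while the product rule for
  \<open>n = \<partial>\<^sub>1v \<times> \<partial>\<^sub>2v\<close> gives \<open>\<partial>\<^sub>jv \<bullet> \<partial>\<^sub>kn = - \<partial>\<^sub>k\<partial>\<^sub>jv \<bullet> n\<close>.  Since the \<open>\<partial>\<^sub>jv\<close> are only weakly differentiable, this
  needs the product rule for bounded weakly differentiable functions, the symmetry of weak second
  derivatives and the fundamental lemma of the calculus of variations.  As \<open>\<bar>n\<bar> = 1\<close> and \<open>Q_hom\<close>
  is a quadratic form that sees only symmetric parts, both equalities are then algebra.\<close>

subsection \<open>Partial derivatives of smooth functions\<close>

lemma pd_eqI:
  assumes "(f has_derivative D) (at x)"
  shows "pd j f x = D (axis j 1)"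
  unfolding pd_def using frechet_derivative_at[OF assms] by simp

text \<open>Functions that agree near \<open>x\<close> have the same derivatives there, so the
  choice operator inside \<open>frechet_derivative\<close> returns the same map, also at points
  where no derivative exists.\<close>

lemma pd_cong_near:
  assumes "eventually (\<lambda>y. f y = g y) (nhds x)"
  shows "pd j f x = pd j g x"
proof -
  obtain U where U: "open U" "x \<in> U" "\<And>y. y \<in> U \<Longrightarrow> f y = g y"
    using assms by (auto simp: eventually_nhds)
  have "(f has_derivative D) (at x) = (g has_derivative D) (at x)" for D
    using U has_derivative_transform_within_open[of _ D x UNIV U] by metis
  then show ?thesis unfolding pd_def frechet_derivative_def by simp
qed

lemma pd_support:
  assumes "closed T" "\<And>y. f y \<noteq> 0 \<Longrightarrow> y \<in> T" "pd j f x \<noteq> 0"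
  shows "x \<in> T"
proof (rule ccontr)
  assume "x \<notin> T"
  then have "eventually (\<lambda>y. y \<in> - T) (nhds x)" using assms(1) by (intro eventually_nhds_in_open) auto
  then have "eventually (\<lambda>y. f y = 0) (nhds x)"
    by (rule eventually_mono) (use assms(2) in blast)
  then have "pd j f x = pd j (\<lambda>x. 0) x" by (rule pd_cong_near)
  also have "\<dots> = 0" by (rule pd_eqI) simp
  finally show False using assms(3) by simp
qed

section \<open>Closure properties of the classes \<open>C_k\<close>\<close>

lemma C_k_SucI:
  assumes "\<And>x. (f has_derivative D x) (at x)" and "\<And>j. C_k k (\<lambda>x. D x (axis j 1))"
  shows "C_k (Suc k) f"
proof -
  have "pd j f = (\<lambda>x. D x (axis j 1))" for j using pd_eqI[OF assms(1)] by blast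
  then show ?thesis using assms by (auto simp: differentiable_def)
qed

lemma C_k_Suc_has_derivative:
  "C_k (Suc k) f \<Longrightarrow> (f has_derivative frechet_derivative f (at x)) (at x)"
  by (simp add: frechet_derivative_works)

lemma C_k_continuous: "C_k k f \<Longrightarrow> continuous_on UNIV f"
  by (cases k) (auto intro!: differentiable_imp_continuous_on simp: differentiable_on_def)

lemma C_k_SucD: "C_k (Suc k) f \<Longrightarrow> C_k k f"
proof (induction k arbitrary: f)
  case 0 then show ?case using C_k_continuous[of "Suc 0" f] by simp
qed auto

lemma C_k_const: "C_k k (\<lambda>x. c)"
proof (induction k arbitrary: c)
  case (Suc k)
  show ?case by (rule C_k_SucI[of _ "\<lambda>x y. 0"]) (auto simp: Suc)
qed simp

lemma C_k_add: "C_k k f \<Longrightarrow> C_k k g \<Longrightarrow> C_k k (\<lambda>x. f x + g x)"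
proof (induction k arbitrary: f g)
  case (Suc k)
  show ?case
    by (rule C_k_SucI[OF has_derivative_add[OF C_k_Suc_has_derivative[OF Suc(2)]
      C_k_Suc_has_derivative[OF Suc(3)]]])
      (use Suc in \<open>auto simp: pd_def[symmetric, abs_def]\<close>)
qed (auto intro: continuous_intros)

lemma C_k_mult: "C_k k f \<Longrightarrow> C_k k g \<Longrightarrow> C_k k (\<lambda>x. f x * g x)"
proof (induction k arbitrary: f g)
  case (Suc k)
  have p: "C_k k f" "C_k k g" "\<And>j. C_k k (pd j f)" "\<And>j. C_k k (pd j g)"
    using Suc(2,3) C_k_SucD by auto
  show ?case
    by (rule C_k_SucI[OF has_derivative_mult[OF C_k_Suc_has_derivative[OF Suc(2)]
      C_k_Suc_has_derivative[OF Suc(3)]]])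
      (use Suc.IH p in \<open>auto simp: pd_def[symmetric, abs_def] intro!: C_k_add\<close>)
qed (auto intro: continuous_intros)

lemma C_k_prod:
  assumes "\<And>i. i \<in> I \<Longrightarrow> C_k k (f i)"
  shows "C_k k (\<lambda>x. \<Prod>i\<in>I. f i x)"
  using assms by (induction I rule: infinite_finite_induct) (auto simp: C_k_const intro: C_k_mult)

text \<open>The cases \<open>c = -1\<close> and \<open>c = 1\<close> give the reflections f(y - x)
  and the translates f(x + y) that appear in convolution-type test functions.\<close>

lemma has_derivative_affine_compose:
  fixes f :: "real^'n::finite \<Rightarrow> real"
  assumes "f differentiable (at (c *\<^sub>R x + a))"
  shows "((\<lambda>x. f (c *\<^sub>R x + a)) has_derivative
           (\<lambda>h. c * frechet_derivative f (at (c *\<^sub>R x + a)) h)) (at x)"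
proof -
  have d: "(f has_derivative frechet_derivative f (at (c *\<^sub>R x + a))) (at (c *\<^sub>R x + a))"
    using assms frechet_derivative_works by blast
  have "((\<lambda>x. f (c *\<^sub>R x + a)) has_derivative
           (\<lambda>h. frechet_derivative f (at (c *\<^sub>R x + a)) (c *\<^sub>R h))) (at x)"
    by (rule has_derivative_compose[of "\<lambda>x. c *\<^sub>R x + a" "\<lambda>h. c *\<^sub>R h" x UNIV f, OF _ d])
      (auto intro!: derivative_eq_intros)
  then show ?thesis
    using linear_scale[OF has_derivative_linear[OF d]] by simp
qed

lemma pd_affine_compose:
  fixes f :: "real^'n::finite \<Rightarrow> real"
  assumes "f differentiable (at (c *\<^sub>R x + a))"
  shows "pd j (\<lambda>x. f (c *\<^sub>R x + a)) x = c * pd j f (c *\<^sub>R x + a)"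
  using pd_eqI[OF has_derivative_affine_compose[OF assms]] by (simp add: pd_def)

lemma C_k_affine_compose: "C_k k f \<Longrightarrow> C_k k (\<lambda>x. f (c *\<^sub>R x + a))"
proof (induction k arbitrary: f)
  case 0
  then show ?case by (auto intro!: continuous_intros continuous_on_compose2[of UNIV f])
next
  case (Suc k)
  have "C_k k (\<lambda>x. c * pd j f (c *\<^sub>R x + a))" for j
    by (rule C_k_mult[OF C_k_const]) (use Suc in auto)
  then show ?case
    by (intro C_k_SucI[OF has_derivative_affine_compose]) (use Suc in \<open>auto simp: pd_def\<close>)
qed

lemma C_k_reflect: "C_k k f \<Longrightarrow> C_k k (\<lambda>x. f (y - x))"
  using C_k_affine_compose[of k f "-1" y] by simp

lemma pd_reflect: "C_k (Suc 0) f \<Longrightarrow> pd j (\<lambda>x. f (y - x)) x = - pd j f (y - x)"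
  using pd_affine_compose[of f "-1" x y j] by simp

lemma C_k_translate: "C_k k f \<Longrightarrow> C_k k (\<lambda>x. f (x + y))"
  using C_k_affine_compose[of k f 1 y] by simp

lemma pd_translate: "C_k (Suc 0) f \<Longrightarrow> pd j (\<lambda>x. f (x + y)) x = pd j f (x + y)"
  using pd_affine_compose[of f "1" x y j] by simp

lemma pd_mult:
  assumes "C_k (Suc 0) f" "C_k (Suc 0) g"
  shows "pd j (\<lambda>x. f x * g x) x = f x * pd j g x + pd j f x * g x"
  using pd_eqI[OF has_derivative_mult[OF C_k_Suc_has_derivative[OF assms(1)]
    C_k_Suc_has_derivative[OF assms(2)]]]
  by (simp add: pd_def)

subsection \<open>A smooth bump\<close>

text \<open>For \<open>n = 0\<close> this is the classical smooth function exp(-1/t), continued by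
  0. The extra powers of 1/t make the family closed under differentiation up to linear combinations,
  so smoothness follows by induction.\<close>

definition exp_bump :: "nat \<Rightarrow> real \<Rightarrow> real" where
  "exp_bump n t = (if t > 0 then (1/t)^n * exp (- (1/t)) else 0)"

text \<open>With s = 1/t the limit from the right is that of s^n / exp s at infinity; on the left
  the function is constantly 0.\<close>

lemma exp_bump_tendsto_0: "(exp_bump n \<longlongrightarrow> 0) (at 0)"
proof -
  have "((\<lambda>t::real. (1/t)^n / exp (1/t)) \<longlongrightarrow> 0) (at_right 0)"
    using filterlim_compose[OF tendsto_power_div_exp_0 filterlim_inverse_at_top_right, of n]
    by (simp add: inverse_eq_divide)
  then have "(exp_bump n \<longlongrightarrow> 0) (at_right 0)"
    by (rule Lim_transform_eventually)
      (auto simp: exp_bump_def exp_minus divide_inverse eventually_at_right_less intro!: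
        eventually_at_rightI[of 0 1])
  moreover have "(exp_bump n \<longlongrightarrow> 0) (at_left 0)"
    by (rule tendsto_eventually) (auto simp: exp_bump_def intro!: eventually_at_leftI[of "-1" 0])
  ultimately show ?thesis by (simp add: filterlim_split_at)
qed

lemma diff_mult_minus_expand:
  fixes a b q e :: "'a::comm_ring_1"
  shows "a * q = c \<Longrightarrow> (a * e - b * e) * - q = - c * e + b * q * e"
  by (auto simp: algebra_simps)

lemma exp_bump_DERIV:
  "(exp_bump n has_real_derivative (- real n * exp_bump (Suc n) t + exp_bump (n+2) t)) (at t)"
proof -
  consider "t > 0" | "t < 0" | "t = 0" by linarith
  then show ?thesis
  proof cases
    case 1
    have "((\<lambda>t. (1/t)^n * exp (- (1/t))) has_real_derivative
            (- real n * exp_bump (Suc n) t + exp_bump (n+2) t)) (at t)"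
    proof -
      have "((\<lambda>t. t ^ n * exp (- t)) has_real_derivative
          (real n * (1/t) ^ (n - 1) * exp (- (1/t)) - (1/t) ^ n * exp (- (1/t)))) (at (1/t))"
        by (auto intro!: derivative_eq_intros)
      moreover have "((\<lambda>t. 1/t) has_real_derivative - ((1/t) ^ 2)) (at t)"
        using 1 by (auto intro!: derivative_eq_intros simp: power2_eq_square)
      ultimately have "((\<lambda>t. (1/t) ^ n * exp (- (1/t))) has_real_derivative
          (real n * (1/t) ^ (n - 1) * exp (- (1/t)) - (1/t) ^ n * exp (- (1/t))) * - ((1/t) ^ 2)) (at t)"
        by (rule DERIV_chain2)
      \<comment> \<open>For \<open>n = 0\<close> the truncated exponent \<open>n - 1\<close> does no
        harm, since the factor \<open>real n\<close> vanishes.\<close>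
      moreover have "real n * (1/t) ^ (n - 1) * (1/t)\<^sup>2 = real n * (1/t) ^ Suc n"
        by (cases n) (auto simp: power2_eq_square)
      then have "(real n * (1/t) ^ (n - 1) * exp (- (1/t)) - (1/t) ^ n * exp (- (1/t))) * - ((1/t) ^ 2)
          = - (real n * (1/t) ^ Suc n) * exp (- (1/t)) + (1/t) ^ (n + 2) * exp (- (1/t))"
        by (metis (no_types) diff_mult_minus_expand power_add)
      ultimately show ?thesis
        using 1 by (simp add: exp_bump_def mult.assoc)
    qed
    then show ?thesis
      by (rule DERIV_cong_ev[THEN iffD1, rotated -1])
        (use 1 eventually_nhds_in_open[of "{0<..}" t] in \<open>auto simp: exp_bump_def elim!: eventually_mono\<close>)
  next
    case 2
    have "((\<lambda>t. 0) has_real_derivative (- real n * exp_bump (Suc n) t + exp_bump (n+2) t)) (at t)"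
      using 2 by (auto simp: exp_bump_def)
    then show ?thesis
      by (rule DERIV_cong_ev[THEN iffD1, rotated -1])
        (use 2 eventually_nhds_in_open[of "{..<0}" t] in \<open>auto simp: exp_bump_def elim!: eventually_mono\<close>)
  next
    case 3
    \<comment> \<open>At the origin the difference quotient is the next member of the family, which
      tends to 0; the claimed derivative is 0 there as well.\<close>
    have "exp_bump n h / h = exp_bump (Suc n) h" for h by (auto simp: exp_bump_def)
    moreover have "exp_bump k 0 = 0" for k by (simp add: exp_bump_def)
    ultimately show ?thesis using 3 exp_bump_tendsto_0[of "Suc n"]
      by (simp add: DERIV_def)
  qed
qed

text \<open>The induction on \<open>k\<close> covers all \<open>n\<close> at once because
  differentiating raises the index. The affine argument provides both half-spaces bounding a cube in
  direction \<open>i\<close>.\<close>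

lemma C_k_exp_bump: "C_k k (\<lambda>x::real^'n::finite. exp_bump n (c * x $ i + d))"
proof (induction k arbitrary: n)
  case 0
  have "continuous_on UNIV (exp_bump n)"
    by (intro DERIV_continuous_on) (auto intro: DERIV_subset[OF exp_bump_DERIV])
  then show ?case by (auto intro!: continuous_intros continuous_on_compose2[of UNIV "exp_bump n"])
next
  case (Suc k)
  have *: "((\<lambda>x::real^'n. exp_bump n (c * x $ i + d)) has_derivative
         (\<lambda>h. (- real n * exp_bump (Suc n) (c * x $ i + d) + exp_bump (n+2) (c * x $ i +
           d)) * (c * h $ i))) (at x)" for x
    by (rule has_derivative_compose[OF _ exp_bump_DERIV[unfolded has_field_derivative_def]])
      (auto intro!: derivative_eq_intros bounded_linear_imp_has_derivative bounded_linear_vec_nth)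
  show ?case
    by (rule C_k_SucI[OF *]) (intro C_k_mult C_k_add C_k_const Suc)
qed

lemma exists_smooth_bump:
  assumes "\<epsilon> > 0"
  obtains \<rho> :: "real^'n::finite \<Rightarrow> real" where "\<And>k. C_k k \<rho>" "\<And>x. \<rho> x \<ge> 0" "\<rho> 0 > 0"
    "\<And>x. \<rho> x \<noteq> 0 \<Longrightarrow> norm x < \<epsilon>"
proof
  \<comment> \<open>The product below is supported in the cube with all coordinates less than
    \<open>e\<close> in modulus. Dividing by the dimension makes the l1 norm, hence the Euclidean
    norm, less than \<open>\<epsilon>\<close>.\<close>
  define e where "e = \<epsilon> / CARD('n)"
  define \<rho> where "\<rho> = (\<lambda>x::real^'n. \<Prod>i\<in>UNIV. exp_bump 0 (1 * x $ i + e) * exp_bump 0 ((-1) * x $ i + e))"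
  have e: "e > 0" using assms by (simp add: e_def)
  show "C_k k \<rho>" for k unfolding \<rho>_def by (intro C_k_prod C_k_mult C_k_exp_bump)
  show "\<rho> x \<ge> 0" for x unfolding \<rho>_def by (intro prod_nonneg) (auto simp: exp_bump_def)
  show "\<rho> 0 > 0" unfolding \<rho>_def by (intro prod_pos) (use e in \<open>auto simp: exp_bump_def\<close>)
  show "norm x < \<epsilon>" if "\<rho> x \<noteq> 0" for x
  proof -
    have "\<bar>x $ i\<bar> < e" for i
    proof -
      have "exp_bump 0 (1 * x $ i + e) \<noteq> 0 \<and> exp_bump 0 ((-1) * x $ i + e) \<noteq> 0"
        using that by (auto simp: \<rho>_def)
      then show ?thesis by (auto simp: exp_bump_def split: if_splits)
    qed
    then have "(\<Sum>i\<in>UNIV. \<bar>x $ i\<bar>) < (\<Sum>i\<in>(UNIV::'n set). e)" by (intro sum_strict_mono) auto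
    then show ?thesis using norm_le_l1_cart[of x] by (simp add: e_def)
  qed
qed

subsection \<open>Test functions\<close>

lemma test_functionI:
  assumes "\<And>k. C_k k \<phi>" "compact K" "K \<subseteq> S" "\<And>x. \<phi> x \<noteq> 0 \<Longrightarrow> x \<in> K"
  shows "test_function S \<phi>"
proof -
  have "closure {x. \<phi> x \<noteq> 0} \<subseteq> K" using assms by (intro closure_minimal compact_imp_closed) auto
  moreover then have "compact (closure {x. \<phi> x \<noteq> 0})"
    using assms(2) closed_closure compact_Int_closed[of K] by (metis inf.absorb_iff2)
  ultimately show ?thesis using assms by (auto simp: test_function_def)
qed

lemma test_functionE:
  assumes "test_function S \<phi>"
  obtains K where "\<And>k. C_k k \<phi>" "compact K" "K \<subseteq> S" "\<And>x. \<phi> x \<noteq> 0 \<Longrightarrow> x \<in> K"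
    "\<And>j x. pd j \<phi> x \<noteq> 0 \<Longrightarrow> x \<in> K"
proof -
  let ?K = "closure {x. \<phi> x \<noteq> 0}"
  have 1: "\<phi> x \<noteq> 0 \<Longrightarrow> x \<in> ?K" for x
    by (rule subsetD[OF closure_subset]) simp
  have 2: "pd j \<phi> x \<noteq> 0 \<Longrightarrow> x \<in> ?K" for j x
    by (rule pd_support[OF closed_closure 1])
  show ?thesis
    using that[OF _ _ _ 1 2] assms by (simp add: test_function_def)
qed

lemma test_function_pd:
  assumes "test_function S \<phi>"
  shows "test_function S (pd j \<phi>)"
proof -
  obtain K where K: "\<And>k. C_k k \<phi>" "compact K" "K \<subseteq> S" "\<And>j x. pd j \<phi> x \<noteq> 0 \<Longrightarrow> x \<in> K"
    using test_functionE[OF assms] by metis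
  have "C_k k (pd j \<phi>)" for k using K(1)[of "Suc k"] by simp
  then show ?thesis using K(4) by (rule test_functionI[OF _ K(2,3)])
qed

lemma test_function_mult:
  assumes "test_function S \<phi>" "\<And>k. C_k k \<psi>"
  shows "test_function S (\<lambda>x. \<phi> x * \<psi> x)"
  using assms(1) by (rule test_functionE) (rule test_functionI, auto intro: C_k_mult assms)

lemma continuous_compact_support_bounded:
  fixes \<phi> :: "'a::euclidean_space \<Rightarrow> real"
  assumes "continuous_on UNIV \<phi>" "compact K" "\<And>x. \<phi> x \<noteq> 0 \<Longrightarrow> x \<in> K"
  obtains C where "C > 0" "\<And>x. \<bar>\<phi> x\<bar> \<le> C"
proof -
  have "bounded (\<phi> ` K)"
    using assms continuous_on_subset compact_continuous_image compact_imp_bounded by blast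
  then obtain C where "C > 0" "\<And>x. x \<in> K \<Longrightarrow> \<bar>\<phi> x\<bar> \<le> C"
    by (auto simp: bounded_pos)
  then show ?thesis using assms(3) that[of C] by force
qed

subsection \<open>Translation continuity of correlations\<close>

lemma lborel_integral_translation:
  fixes f :: "'a::euclidean_space \<Rightarrow> real"
  assumes [measurable]: "f \<in> borel_measurable borel"
  shows "(LINT x|lborel. f (x + z)) = (LINT x|lborel. f x)"
proof -
  have "(LINT x|lborel. f x) = (LINT x|distr lborel borel ((+) z). f x)"
    by (simp add: lborel_distr_plus)
  also have "\<dots> = (LINT x|lborel. f (z + x))" by (rule integral_distr) auto
  finally show ?thesis by (simp add: add.commute)
qed

lemma integrable_mult_bounded:
  fixes f \<psi> :: "'a \<Rightarrow> real"
  assumes "integrable M f" "\<psi> \<in> borel_measurable M" "\<And>x. \<bar>\<psi> x\<bar> \<le> C"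
  shows "integrable M (\<lambda>x. f x * \<psi> x)"
proof (rule Bochner_Integration.integrable_bound)
  show "integrable M (\<lambda>x. C * \<bar>f x\<bar>)" using assms by auto
  show "(\<lambda>x. f x * \<psi> x) \<in> borel_measurable M" using assms by auto
  have "\<bar>f x * \<psi> x\<bar> \<le> \<bar>C * \<bar>f x\<bar>\<bar>" for x
  proof -
    have "\<bar>f x * \<psi> x\<bar> \<le> \<bar>f x\<bar> * C" unfolding abs_mult by (intro mult_left_mono assms) simp
    also have "\<dots> \<le> \<bar>C * \<bar>f x\<bar>\<bar>" by (simp add: mult.commute)
    finally show ?thesis .
  qed
  then show "AE x in M. norm (f x * \<psi> x) \<le> norm (C * \<bar>f x\<bar>)" by simp
qed

text \<open>The cross-correlation. At \<open>z = 0\<close> it is the integral of the product, and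
  this is the value that is extracted later.\<close>

definition corr :: "('a::euclidean_space \<Rightarrow> real) \<Rightarrow> ('a \<Rightarrow> real) \<Rightarrow> 'a \<Rightarrow> real" where
  "corr f \<psi> z = (LINT x|lborel. f x * \<psi> (x + z))"

text \<open>A weak form of L1-continuity of translations. Quantifying over all bounded Borel
  \<open>\<psi>\<close> makes it a property of \<open>f\<close> alone, which can be transported from
  simple functions to all integrable ones.\<close>

definition corr_continuous :: "('a::euclidean_space \<Rightarrow> real) \<Rightarrow> bool" where
  "corr_continuous f \<longleftrightarrow> (\<forall>\<psi>\<in>borel_measurable borel. \<forall>C. (\<forall>x. \<bar>\<psi> x\<bar> \<le> C) \<longrightarrow> isCont (corr f \<psi>) 0)"

lemma corr_integrable:
  fixes f \<psi> :: "'a::euclidean_space \<Rightarrow> real"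
  assumes "integrable lborel f" "\<psi> \<in> borel_measurable borel" "\<And>x. \<bar>\<psi> x\<bar> \<le> C"
  shows "integrable lborel (\<lambda>x. f x * \<psi> (x + z))"
  using assms by (intro integrable_mult_bounded[of _ _ _ C]) auto

text \<open>The map from \<open>f\<close> to \<open>corr f \<psi> z\<close> is Lipschitz for the L1
  norm with the constant \<open>C\<close> for every \<open>z\<close>, so continuity at 0 survives L1
  limits by a three-epsilon argument.\<close>

lemma corr_continuous_closed:
  fixes f :: "'a::euclidean_space \<Rightarrow> real"
  assumes f: "integrable lborel f"
    and approx: "\<And>e. e > 0 \<Longrightarrow> \<exists>g. integrable lborel g \<and> corr_continuous g \<and> (LINT x|lborel. \<bar>f x - g
      x\<bar>) < e"
  shows "corr_continuous f"
  unfolding corr_continuous_def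
proof (intro ballI allI impI)
  fix \<psi> :: "'a \<Rightarrow> real" and C assume \<psi>[measurable]: "\<psi> \<in> borel_measurable borel" and C: "\<forall>x. \<bar>\<psi> x\<bar> \<le> C"
  then have C0: "C \<ge> 0" by (meson abs_ge_zero order_trans)
  show "isCont (corr f \<psi>) 0" unfolding continuous_at_eps_delta
  proof (intro allI impI)
    fix e :: real assume "e > 0"
    \<comment> \<open>Adding 1 to \<open>C\<close> avoids division by zero when
      \<open>C = 0\<close>.\<close>
    define e' where "e' = e / (3 * (C + 1))"
    have e': "e' > 0" "C * e' \<le> e / 3" using \<open>e > 0\<close> C0 by (auto simp: e'_def field_simps)
    obtain g where g: "integrable lborel g" "corr_continuous g" "(LINT x|lborel. \<bar>f x - g x\<bar>) < e'"
      using approx e' by blast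
    have diff: "\<bar>corr f \<psi> z - corr g \<psi> z\<bar> \<le> e / 3" for z
    proof -
      have i: "integrable lborel (\<lambda>x. f x * \<psi> (x + z))" "integrable lborel (\<lambda>x. g x * \<psi> (x + z))"
        using f g C by (auto intro!: corr_integrable)
      have "\<bar>corr f \<psi> z - corr g \<psi> z\<bar> = \<bar>LINT x|lborel. (f x - g x) * \<psi> (x + z)\<bar>"
        unfolding corr_def using i by (simp add: left_diff_distrib)
      also have "\<dots> \<le> (LINT x|lborel. \<bar>(f x - g x) * \<psi> (x + z)\<bar>)" by simp
      also have "\<dots> \<le> (LINT x|lborel. C * \<bar>f x - g x\<bar>)"
      proof (rule integral_mono)
        show "integrable lborel (\<lambda>x. \<bar>(f x - g x) * \<psi> (x + z)\<bar>)" using i by (simp add: left_diff_distrib)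
        show "integrable lborel (\<lambda>x. C * \<bar>f x - g x\<bar>)" using f g(1) by auto
        show "\<bar>(f x - g x) * \<psi> (x + z)\<bar> \<le> C * \<bar>f x - g x\<bar>" for x
          using C by (simp add: abs_mult mult.commute[of "\<bar>f x - g x\<bar>"] mult_right_mono)
      qed
      also have "\<dots> \<le> C * e'" using g(3) C0 by (simp add: mult_left_mono)
      finally show ?thesis using e' by simp
    qed
    have "isCont (corr g \<psi>) 0" using g(2) \<psi> C unfolding corr_continuous_def by blast
    then obtain d where d: "d > 0" "\<And>z. norm z < d \<Longrightarrow> \<bar>corr g \<psi> z - corr g \<psi> 0\<bar> < e / 3"
      using \<open>e > 0\<close> unfolding continuous_at_eps_delta dist_norm
      by (metis diff_zero divide_pos_pos real_norm_def zero_less_numeral)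
    then have "\<bar>corr f \<psi> z - corr f \<psi> 0\<bar> < e" if "norm z < d" for z
      using diff[of z] diff[of 0] d(2)[OF that] by linarith
    then show "\<exists>d>0. \<forall>x'. dist x' 0 < d \<longrightarrow> dist (corr f \<psi> x') (corr f \<psi> 0) < e"
      using \<open>d > 0\<close> by (auto simp: dist_norm)
  qed
qed

text \<open>Translation invariance moves the shift from \<open>\<psi>\<close>, which is only
  measurable, onto the continuous \<open>g\<close>; then dominated convergence applies. A bounded
  sequence of shifts keeps all supports in one ball.\<close>

lemma corr_continuous_continuous:
  fixes g :: "'a::euclidean_space \<Rightarrow> real"
  assumes g: "continuous_on UNIV g" and C: "\<And>x. \<bar>g x\<bar> \<le> C" and R: "\<And>x. g x \<noteq> 0 \<Longrightarrow> norm x \<le> R"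
  shows "integrable lborel g" "corr_continuous g"
proof -
  have gm[measurable]: "g \<in> borel_measurable borel" using g by (rule borel_measurable_continuous_onI)
  have C0: "C \<ge> 0" using C by (meson abs_ge_zero order_trans)
  have dom: "integrable lborel (\<lambda>x::'a. D * indicator (cball 0 r) x :: real)" for D r :: real
    using emeasure_lborel_cball_finite[of "0::'a" r]
      by (intro integrable_mult_right) (auto simp: integrable_indicator_iff)
  show int: "integrable lborel g"
    by (rule Bochner_Integration.integrable_bound[OF dom[of C R]]) (use C C0 R in \<open>auto simp: indicator_def\<close>)
  show "corr_continuous g" unfolding corr_continuous_def
  proof (intro ballI allI impI)
    fix \<psi> :: "'a \<Rightarrow> real" and D assume \<psi>[measurable]: "\<psi> \<in> borel_measurable borel" and D: "\<forall>x. \<bar>\<psi> x\<bar> \<le> D"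
    have D0: "D \<ge> 0" using D by (meson abs_ge_zero order_trans)
    have eq: "corr g \<psi> z = (LINT x|lborel. g (x - z) * \<psi> x)" for z
      unfolding corr_def using lborel_integral_translation[of "\<lambda>x. g (x - z) * \<psi> x" z] by simp
    show "isCont (corr g \<psi>) 0" unfolding continuous_at_sequentially o_def eq
    proof (intro allI impI)
      fix z :: "nat \<Rightarrow> 'a" assume z: "z \<longlonglongrightarrow> 0"
      then have "Bseq z" by (intro convergent_imp_Bseq convergentI)
      then obtain r where r: "\<And>n. norm (z n) \<le> r" unfolding Bseq_def by blast
      show "(\<lambda>n. LINT x|lborel. g (x - z n) * \<psi> x) \<longlonglongrightarrow> (LINT x|lborel. g (x - 0) * \<psi> x)"
      proof (rule integral_dominated_convergence[where w = "\<lambda>x. (C * D) * indicator (cball 0 (R +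
        r)) x"])
        show "AE x in lborel. (\<lambda>i. g (x - z i) * \<psi> x) \<longlonglongrightarrow> g (x - 0) * \<psi> x"
          using g z by (intro AE_I2 tendsto_intros continuous_on_tendsto_compose[OF g]) (auto
            intro!: tendsto_eq_intros)
        have "\<bar>g (x - z i) * \<psi> x\<bar> \<le> C * D * indicator (cball 0 (R + r)) x" for i x
        proof (cases "g (x - z i) = 0")
          case False
          then have "norm x \<le> R + r" using R[of "x - z i"] r[of i] norm_triangle_sub[of x "z i"]
            by linarith
          then show ?thesis using C[of "x - z i"] D by (simp add: abs_mult mult_mono)
        qed (use C0 D0 in auto)
        then show "AE x in lborel. norm (g (x - z i) * \<psi> x) \<le> C * D * indicator (cball 0 (R + r)) x"
          for i by simp
      qed (use dom in auto)
    qed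
  qed
qed

text \<open>The indicator is the L1 limit of the continuous cutoffs \<open>g n\<close>, which equal
  1 on \<open>K\<close> and fall linearly to 0 within distance 1/n of it.\<close>

lemma corr_continuous_compact:
  fixes K :: "'a::euclidean_space set"
  assumes K: "compact K"
  shows "corr_continuous (indicator K :: 'a \<Rightarrow> real)"
\<comment> \<open>The empty set is separate because \<open>infdist x {} = 0\<close> would make every
  cutoff constantly 1.\<close>
proof (cases "K = {}")
  case True
  then show ?thesis by (simp add: corr_continuous_def corr_def[abs_def])
next
  case False
  define g where "g n x = max 0 (1 - real n * infdist x K)" for n x
  obtain R where R: "\<And>x. x \<in> K \<Longrightarrow> norm x \<le> R" using compact_imp_bounded[OF K] by (auto simp: bounded_iff)
  have gc: "continuous_on UNIV (g n)" for n unfolding g_def by (intro continuous_intros)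
  have g1: "\<bar>g n x\<bar> \<le> 1" for n x using infdist_nonneg[of x K] by (auto simp: g_def)
  \<comment> \<open>The indices start at 1, as \<open>g 0\<close> is constantly 1 and has unbounded
    support.\<close>
  have gR: "norm x \<le> R + 1" if "g (Suc n) x \<noteq> 0" for n x
  proof -
    have "real (Suc n) * infdist x K < 1" using that by (auto simp: g_def max_def split: if_splits)
    moreover have "infdist x K \<le> real (Suc n) * infdist x K" using infdist_nonneg[of x K]
      by (simp add: mult_le_cancel_right1)
    ultimately have "infdist x K < 1" by linarith
    then obtain y where "y \<in> K" "dist x y < 1" using infdist_attains_inf[of K x]
      False K compact_imp_closed by metis
    then show ?thesis using R[of y] norm_triangle_sub[of x y] by (simp add: dist_norm)
  qed
  have gi: "integrable lborel (g (Suc n))" "corr_continuous (g (Suc n))" for n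
    using corr_continuous_continuous[of "g (Suc n)" 1 "R + 1", OF gc g1 gR] by auto
  have Kf: "emeasure lborel K < \<infinity>" by (rule emeasure_bounded_finite) (use K compact_imp_bounded in auto)
  have Ki: "integrable lborel (indicator K :: 'a \<Rightarrow> real)"
    using K Kf borel_compact by (auto simp: integrable_indicator_iff)
  have "(\<lambda>n. LINT x|lborel. \<bar>indicator K x - g (Suc n) x\<bar>) \<longlonglongrightarrow> (LINT x::'a|lborel. (0::real))" 
  proof (rule integral_dominated_convergence[where w = "\<lambda>x. indicator K x + g 1 x"])
    have "(\<lambda>n. \<bar>indicator K x - g (Suc n) x\<bar>) \<longlonglongrightarrow> 0" for x
    proof (cases "x \<in> K")
      case True then show ?thesis by (simp add: g_def)
    next
      case f: False
      then have p: "infdist x K > 0" using K compact_imp_closed False infdist_pos_not_in_closed by blast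
      obtain N :: nat where N: "1 / infdist x K < real N" using reals_Archimedean2 by blast
      have "g (Suc n) x = 0" if "n \<ge> N" for n
      proof -
        have "1 / infdist x K < real (Suc n)" using N that by linarith
        then show ?thesis using p by (simp add: g_def field_simps)
      qed
      then show ?thesis using f by (intro tendsto_eventually eventually_sequentiallyI[of N]) auto
    qed
    then show "AE x in lborel. (\<lambda>n. \<bar>indicator K x - g (Suc n) x\<bar>) \<longlonglongrightarrow> 0" by simp
    have "g (Suc n) x \<le> g 1 x" for n x
    proof -
      have "infdist x K \<le> real (Suc n) * infdist x K"
        using infdist_nonneg[of x K] by (simp add: mult_le_cancel_right1)
      then show ?thesis by (simp add: g_def)
    qed
    then have "\<bar>indicator K x - g (Suc n) x\<bar> \<le> indicator K x + g 1 x" for n x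
      using abs_triangle_ineq4[of "indicator K x" "g (Suc n) x"] by (smt (verit) g_def indicator_pos_le)
    then show "AE x in lborel. norm \<bar>indicator K x - g (Suc n) x\<bar> \<le> indicator K x + g 1 x" for n by simp
    show "integrable lborel (\<lambda>x. indicator K x + g 1 x)" using Ki gi(1)[of 0] by simp
    show "(\<lambda>x. \<bar>indicator K x - g (Suc n) x\<bar>) \<in> borel_measurable lborel" for n
      using Ki gi(1)[of n] by auto
  qed auto
  then have lim: "(\<lambda>n. LINT x|lborel. \<bar>indicator K x - g (Suc n) x\<bar>) \<longlonglongrightarrow> 0" by simp
  show ?thesis
  proof (rule corr_continuous_closed[OF Ki])
    fix e :: real assume "e > 0"
    then obtain n where "(LINT x|lborel. \<bar>indicator K x - g (Suc n) x\<bar>) < e"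
      using order_tendstoD(2)[OF lim, of e] by (auto simp: eventually_sequentially)
    then show "\<exists>g. integrable lborel g \<and> corr_continuous g \<and> (LINT x|lborel. \<bar>indicator K x - g x\<bar>) < e"
      using gi by blast
  qed
qed

text \<open>Inner regularity gives a closed \<open>T\<close> inside \<open>A\<close> that misses
  less than e/2 of the measure; cutting \<open>T\<close> with growing balls gives compact sets whose
  indicators come within \<open>e\<close> of that of \<open>A\<close> in L1.\<close>

lemma corr_continuous_indicator:
  fixes A :: "'a::euclidean_space set"
  assumes A: "A \<in> sets borel" "emeasure lborel A < \<infinity>"
  shows "corr_continuous (indicator A :: 'a \<Rightarrow> real)"
proof (rule corr_continuous_closed)
  show Ai: "integrable lborel (indicator A :: 'a \<Rightarrow> real)"
    using A by (intro integrable_real_indicator) auto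
  fix e :: real assume "e > 0"
  obtain T where T: "closed T" "T \<subseteq> A" "emeasure lebesgue (A - T) < ennreal (e/2)"
    using sets_lebesgue_inner_closed[of A "e/2"] A(1) \<open>e > 0\<close>
    by (metis half_gt_zero sets_completionI_sets sets_lborel)
  define K where "K n = T \<inter> cball 0 (real n)" for n
  have Kc: "compact (K n)" for n unfolding K_def using T(1) by (simp add: closed_Int_compact)
  have [measurable]: "T \<in> sets borel" "A \<in> sets borel" using T A by auto
  have Km[measurable]: "K n \<in> sets borel" for n using Kc borel_compact by blast
  have KA: "K n \<subseteq> A" for n using T K_def by auto
  have Ki: "integrable lborel (indicator (K n) :: 'a \<Rightarrow> real)" for n
    by (rule Bochner_Integration.integrable_bound[OF Ai]) (use KA in \<open>auto simp: indicator_def\<close>)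
  have "(\<lambda>n. LINT x|lborel. \<bar>indicator A x - indicator (K n) x\<bar>) \<longlonglongrightarrow>
    (LINT x|lborel. (indicator (A - T) x::real))"
  proof (rule integral_dominated_convergence[where w = "indicator A"])
    have "(\<lambda>n. \<bar>indicator A x - indicator (K n) x\<bar>) \<longlonglongrightarrow> (indicator (A - T) x :: real)" for x
    proof -
      obtain N :: nat where "norm x < real N" using reals_Archimedean2 by blast
      then have "\<bar>indicator A x - indicator (K n) x\<bar> = (indicator (A - T) x :: real)" if "n \<ge> N" for n
        using that T(2) by (auto simp: indicator_def K_def)
      then show ?thesis by (intro tendsto_eventually eventually_sequentiallyI[of N]) auto
    qed
    then show "AE x in lborel. (\<lambda>n. \<bar>indicator A x - indicator (K n) x\<bar>) \<longlonglongrightarrow>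
      (indicator (A - T) x :: real)" by simp
  qed (use Ai Ki KA in \<open>auto simp: indicator_def\<close>)
  moreover have "(LINT x|lborel. (indicator (A - T) x::real)) < e"
  proof -
    have "emeasure lborel (A - T) < ennreal (e/2)" using T(3) by simp
    then have "measure lborel (A - T) \<le> e / 2" using \<open>e > 0\<close>
      unfolding measure_def by (intro enn2real_leI) auto
    then show ?thesis using \<open>e > 0\<close> by simp
  qed
  ultimately have "eventually (\<lambda>n. (LINT x|lborel. \<bar>indicator A x - indicator (K n) x :: real\<bar>) < e)
    sequentially"
    by (rule order_tendstoD(2))
  then obtain n where "(LINT x|lborel. \<bar>indicator A x - indicator (K n) x :: real\<bar>) < e"
    unfolding eventually_sequentially by blast
  then show "\<exists>g. integrable lborel g \<and> corr_continuous g \<and> (LINT x|lborel. \<bar>indicator A x - g x\<bar>) < e"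
    using Ki corr_continuous_compact[OF Kc] by blast
qed

lemma integrable_corr_continuous:
  fixes f :: "'a::euclidean_space \<Rightarrow> real"
  assumes "integrable lborel f"
  shows "corr_continuous f"
  using assms
proof (induction rule: integrable_induct)
  case (base A c)
  then have "corr_continuous (indicator A :: 'a \<Rightarrow> real)" using corr_continuous_indicator by auto
  moreover have "corr (\<lambda>x. indicator A x *\<^sub>R c) \<psi> = (\<lambda>z. c * corr (indicator A) \<psi> z)" for \<psi>
    by (auto simp: corr_def mult.assoc mult.left_commute[of _ c])
  ultimately show ?case unfolding corr_continuous_def by (auto intro!: isCont_mult continuous_const)
next
  case (add f g)
  have "corr (\<lambda>x. f x + g x) \<psi> = (\<lambda>z. corr f \<psi> z + corr g \<psi> z)"
    if "\<psi> \<in> borel_measurable borel" "\<forall>x. \<bar>\<psi> x\<bar> \<le> C" for \<psi> C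
  proof
    fix z
    have "integrable lborel (\<lambda>x. f x * \<psi> (x + z))" "integrable lborel (\<lambda>x. g x * \<psi> (x + z))"
      using that add(1,2) by (auto intro!: corr_integrable)
    then show "corr (\<lambda>x. f x + g x) \<psi> z = corr f \<psi> z + corr g \<psi> z"
      by (simp add: corr_def distrib_right)
  qed
  with add(3,4) show ?case unfolding corr_continuous_def by (auto intro!: isCont_add)
next
  case (lim f s)
  have "(\<lambda>n. LINT x|lborel. \<bar>f x - s n x\<bar>) \<longlonglongrightarrow> (LINT x::'a|lborel. (0::real))"
  \<comment> \<open>The approximating simple functions satisfy the bound 2
    \<open>\<bar>f x\<bar>\<close>, whence the factor 3 for the difference.\<close>
  proof (rule integral_dominated_convergence[where w = "\<lambda>x. 3 * \<bar>f x\<bar>"])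
    have "(\<lambda>n. \<bar>f x - s n x\<bar>) \<longlonglongrightarrow> 0" for x
      using tendsto_rabs[OF tendsto_diff[OF tendsto_const lim.hyps(2)[of x], of "f x"]] by simp
    then show "AE x in lborel. (\<lambda>n. \<bar>f x - s n x\<bar>) \<longlonglongrightarrow> 0" by simp
    have "\<bar>f x - s n x\<bar> \<le> 3 * \<bar>f x\<bar>" for n x using lim.hyps(3)[of x n] by auto
    then show "AE x in lborel. norm \<bar>f x - s n x\<bar> \<le> 3 * \<bar>f x\<bar>" for n by simp
  qed (use lim in auto)
  then have l: "(\<lambda>n. LINT x|lborel. \<bar>f x - s n x\<bar>) \<longlonglongrightarrow> 0" by simp
  show ?case
  proof (rule corr_continuous_closed[OF lim.hyps(4)])
    fix e :: real assume "e > 0"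
    then obtain n where "(LINT x|lborel. \<bar>f x - s n x\<bar>) < e"
      using order_tendstoD(2)[OF l, of e] by (auto simp: eventually_sequentially)
    then show "\<exists>g. integrable lborel g \<and> corr_continuous g \<and> (LINT x|lborel. \<bar>f x - g x\<bar>) < e"
      using lim by blast
  qed
qed

lemma isCont_corr:
  fixes f \<psi> :: "'a::euclidean_space \<Rightarrow> real"
  assumes "integrable lborel f" "\<psi> \<in> borel_measurable borel" "\<And>x. \<bar>\<psi> x\<bar> \<le> C"
  shows "isCont (corr f \<psi>) 0"
  using integrable_corr_continuous[OF assms(1)] assms(2,3) unfolding corr_continuous_def by blast

subsection \<open>Testing against bumps\<close>

lemma integrable_scaleR_bounded:
  fixes f :: "'a \<Rightarrow> 'b::{banach,second_countable_topology}"
  assumes "integrable M f" "\<psi> \<in> borel_measurable M" "\<And>x. \<bar>\<psi> x\<bar> \<le> C"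
  shows "integrable M (\<lambda>x. \<psi> x *\<^sub>R f x)"
proof (rule Bochner_Integration.integrable_bound)
  show "integrable M (\<lambda>x. C * norm (f x))" using assms by auto
  show "(\<lambda>x. \<psi> x *\<^sub>R f x) \<in> borel_measurable M" using assms by auto
  have "norm (\<psi> x *\<^sub>R f x) \<le> norm (C * norm (f x))" for x
    using mult_right_mono[OF order_trans[OF assms(3)[of x] abs_ge_self] norm_ge_zero[of "f x"]]
    by (simp add: abs_mult)
  then show "AE x in M. norm (\<psi> x *\<^sub>R f x) \<le> norm (C * norm (f x))" by simp
qed

text \<open>A vanishing integral would make the nonempty open set where \<open>\<rho>\<close> is
  positive negligible.\<close>

lemma integral_pos_of_continuous:
  fixes \<rho> :: "'a::euclidean_space \<Rightarrow> real"
  assumes i: "integrable lborel \<rho>" and c: "continuous_on UNIV \<rho>" and nn: "\<And>x. \<rho> x \<ge> 0" and p: "\<rho> a > 0"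
  shows "(LINT x|lborel. \<rho> x) > 0"
proof -
  have "(LINT x|lborel. \<rho> x) \<noteq> 0"
  proof
    assume "(LINT x|lborel. \<rho> x) = 0"
    then have "AE x in lborel. \<rho> x = 0" using integral_nonneg_eq_0_iff_AE[OF i] nn by simp
    then have "AE x in lborel. x \<notin> {x. \<rho> x > 0}" by (rule eventually_mono) simp
    then have "AE x in lebesgue. x \<notin> {x. \<rho> x > 0}" by (rule AE_completion)
    moreover have o: "open {x. \<rho> x > 0}" using c by (intro open_Collect_less continuous_intros) auto
    ultimately have "negligible {x. \<rho> x > 0}"
      using AE_iff_null_sets[of "{x. \<rho> x > 0}" lebesgue] by (auto simp: negligible_iff_null_sets)
    then show False using open_not_negligible[OF o] p by blast
  qed
  moreover have "(LINT x|lborel. \<rho> x) \<ge> 0" using nn by simp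
  ultimately show ?thesis by linarith
qed

lemma bump_integrable:
  fixes \<rho> :: "'a::euclidean_space \<Rightarrow> real"
  assumes "continuous_on UNIV \<rho>" "compact K" "\<And>x. \<rho> x \<noteq> 0 \<Longrightarrow> x \<in> K"
  shows "integrable lborel \<rho>"
proof -
  obtain C where C: "C > 0" "\<And>x. \<bar>\<rho> x\<bar> \<le> C" using continuous_compact_support_bounded[OF assms] by metis
  obtain R where "\<And>x. x \<in> K \<Longrightarrow> norm x \<le> R" using compact_imp_bounded[OF assms(2)]
    by (auto simp: bounded_iff)
  then show ?thesis using corr_continuous_continuous(1)[OF assms(1) C(2), of R] assms(3) by blast
qed

text \<open>If \<open>R 0\<close> were nonzero, a bump concentrated where \<open>R\<close> differs
  from \<open>R 0\<close> by less than half of \<open>\<bar>R 0\<bar>\<close> would have a nonzero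
  integral against \<open>R\<close>. The same closeness bounds \<open>R\<close> by 2
  \<open>\<bar>R 0\<bar>\<close> on the support of the bump, which makes the product
  integrable.\<close>

lemma zero_of_bump_integrals:
  fixes R :: "real^'n::finite \<Rightarrow> real"
  assumes R[measurable]: "R \<in> borel_measurable borel" and cont: "isCont R 0" and d: "d > 0"
    and zero: "\<And>\<rho>. (\<And>k. C_k k \<rho>) \<Longrightarrow> (\<And>x. \<rho> x \<noteq> 0 \<Longrightarrow> norm x < d) \<Longrightarrow> (LINT z|lborel. \<rho> z * R z) = 0"
  shows "R 0 = 0"
proof (rule ccontr)
  assume nz: "R 0 \<noteq> 0"
  define s where "s = sgn (R 0)"
  obtain e where e: "e > 0" "\<And>z. norm z < e \<Longrightarrow> \<bar>R z - R 0\<bar> < \<bar>R 0\<bar> / 2"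
    using cont nz unfolding continuous_at_eps_delta dist_norm
    by (metis diff_zero half_gt_zero real_norm_def zero_less_abs_iff)
  obtain \<rho> :: "real^'n \<Rightarrow> real" where \<rho>: "\<And>k. C_k k \<rho>" "\<And>x. \<rho> x \<ge> 0" "\<rho> 0 > 0"
    "\<And>x. \<rho> x \<noteq> 0 \<Longrightarrow> norm x < min d e"
    using exists_smooth_bump[of "min d e"] d e(1) by auto
  have c: "continuous_on UNIV \<rho>" using \<rho>(1) C_k_continuous by blast
  then have [measurable]: "\<rho> \<in> borel_measurable borel" by (rule borel_measurable_continuous_onI)
  have i: "integrable lborel \<rho>"
    by (rule bump_integrable[OF c compact_cball[of 0 "min d e"]]) (use \<rho>(4) in force)
  have b: "\<rho> z * (\<bar>R 0\<bar> / 2) \<le> \<rho> z * R z * s" "\<bar>\<rho> z * R z\<bar> \<le> \<rho> z * (2 * \<bar>R 0\<bar>)" for z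
  proof -
    have "\<bar>R 0\<bar> / 2 \<le> R z * s \<and> \<bar>R z\<bar> \<le> 2 * \<bar>R 0\<bar>" if "\<rho> z \<noteq> 0"
      using e(2)[of z] \<rho>(4)[OF that] nz by (auto simp: s_def sgn_if abs_if split: if_splits)
    then show "\<rho> z * (\<bar>R 0\<bar> / 2) \<le> \<rho> z * R z * s" "\<bar>\<rho> z * R z\<bar> \<le> \<rho> z * (2 * \<bar>R 0\<bar>)"
      using \<rho>(2)[of z] by (cases "\<rho> z = 0"; simp add: abs_mult mult.assoc mult_left_mono)+
  qed
  have "integrable lborel (\<lambda>z. \<rho> z * R z)"
    by (rule Bochner_Integration.integrable_bound[of _ "\<lambda>z. \<rho> z * (2 * \<bar>R 0\<bar>)"])
      (use i b(2) \<rho>(2) in \<open>auto simp: abs_mult\<close>)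
  then have "(LINT z|lborel. \<rho> z * (\<bar>R 0\<bar> / 2)) \<le> (LINT z|lborel. \<rho> z * R z * s)"
    using b(1) i by (intro integral_mono) auto
  also have "\<dots> = 0" using zero[OF \<rho>(1)] \<rho>(4) by simp
  finally show False using integral_pos_of_continuous[OF i c \<rho>(2,3)] nz
    by (simp add: mult_le_0_iff)
qed

subsection \<open>Fubini for convolution-type integrals\<close>

lemma integrable_conv_pair:
  fixes a b r :: "'a::euclidean_space \<Rightarrow> real"
  assumes a: "integrable lborel a" and b: "integrable lborel b"
    and r[measurable]: "r \<in> borel_measurable borel" and C: "\<And>z. \<bar>r z\<bar> \<le> C"
  shows "integrable (lborel \<Otimes>\<^sub>M lborel) (\<lambda>(x, y). a x * (b y * r (y - x)))"
proof -
  have [measurable]: "a \<in> borel_measurable borel" "b \<in> borel_measurable borel"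
    using a b by auto
  have "integrable (lborel \<Otimes>\<^sub>M lborel) (\<lambda>(x, y). a x * b y)"
    by (rule lborel_pair.Fubini_integrable) (use a b in \<open>auto simp: abs_mult\<close>)
  then have "integrable (lborel \<Otimes>\<^sub>M lborel) (\<lambda>p. (case p of (x, y) \<Rightarrow> a x * b y) * r (snd p - fst p))"
    by (rule integrable_mult_bounded) (use C in auto)
  then show ?thesis by (simp add: case_prod_beta' mult.assoc)
qed

lemma conv_swap:
  fixes a b r :: "'a::euclidean_space \<Rightarrow> real"
  assumes a: "integrable lborel a" and b: "integrable lborel b"
    and r[measurable]: "r \<in> borel_measurable borel" and C: "\<And>z. \<bar>r z\<bar> \<le> C"
  shows "(LINT y|lborel. b y * (LINT x|lborel. a x * r (y - x))) =
    (LINT x|lborel. a x * (LINT y|lborel. b y * r (y - x)))"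
    and "integrable lborel (\<lambda>y. b y * (LINT x|lborel. a x * r (y - x)))"
proof -
  note p = integrable_conv_pair[OF assms]
  have e: "(LINT x|lborel. a x * (b y * r (y - x))) = b y * (LINT x|lborel. a x * r (y - x))" for y
    by (simp add: mult.left_commute[of _ "b y"])
  show "(LINT y|lborel. b y * (LINT x|lborel. a x * r (y - x))) =
    (LINT x|lborel. a x * (LINT y|lborel. b y * r (y - x)))"
    using lborel_pair.Fubini_integral[OF p] by (simp add: e)
  show "integrable lborel (\<lambda>y. b y * (LINT x|lborel. a x * r (y - x)))"
    using lborel_pair.integrable_snd[OF p] by (simp add: e)
qed

text \<open>Substitute y = x + z in the inner integral and exchange the order of integration. Fubini
  applies because the inner integral of the absolute value is at most \<open>C\<close> times the L1
  norm of \<open>b\<close>, uniformly in \<open>x\<close>.\<close>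

lemma conv_eq_corr:
  fixes a b r :: "'a::euclidean_space \<Rightarrow> real"
  assumes a: "integrable lborel a" and b: "integrable lborel b"
    and r[measurable]: "r \<in> borel_measurable borel" and C: "\<And>z. \<bar>r z\<bar> \<le> C"
  shows "(LINT x|lborel. a x * (LINT y|lborel. b y * r (y - x))) = (LINT z|lborel. r z * corr a b z)"
    and "integrable lborel (\<lambda>z. r z * corr a b z)"
proof -
  have [measurable]: "a \<in> borel_measurable borel" "b \<in> borel_measurable borel"
    using a b by auto
  have C0: "C \<ge> 0" using C by (meson abs_ge_zero order_trans)
  have tr: "integrable lborel (\<lambda>z. b (x + z))" for x
  proof -
    have "integrable (distr lborel borel ((+) x)) b" using b by (simp add: lborel_distr_plus)
    then show ?thesis by (subst (asm) integrable_distr_eq) auto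
  qed
  have in1: "integrable lborel (\<lambda>z. b (x + z) * r z)" for x
    by (rule integrable_mult_bounded[OF tr]) (use C in auto)
  have p: "integrable (lborel \<Otimes>\<^sub>M lborel) (\<lambda>(x, z). a x * (b (x + z) * r z))"
  proof (rule lborel_pair.Fubini_integrable)
    have bd: "\<bar>LINT z|lborel. \<bar>b (x + z) * r z\<bar>\<bar> \<le> C * (LINT z|lborel. \<bar>b z\<bar>)" for x
    proof -
      have "\<bar>LINT z|lborel. \<bar>b (x + z) * r z\<bar>\<bar> = (LINT z|lborel. \<bar>b (x + z) * r z\<bar>)"
        by simp
      also have "\<dots> \<le> (LINT z|lborel. C * \<bar>b (x + z)\<bar>)"
      proof (rule integral_mono)
        show "\<bar>b (x + z) * r z\<bar> \<le> C * \<bar>b (x + z)\<bar>" for z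
          using C[of z] by (simp add: abs_mult mult.commute[of "\<bar>b (x + z)\<bar>"] mult_right_mono)
      qed (use in1 tr in auto)
      also have "\<dots> = C * (LINT z|lborel. \<bar>b z\<bar>)"
        using lborel_integral_translation[of "\<lambda>z. \<bar>b z\<bar>" x] by (simp add: add.commute)
      finally show ?thesis .
    qed
    have "integrable lborel (\<lambda>x. \<bar>a x\<bar> * (LINT z|lborel. \<bar>b (x + z) * r z\<bar>))"
      by (rule integrable_mult_bounded[OF _ _ bd]) (use a in auto)
    then show "integrable lborel (\<lambda>x. LINT y|lborel. norm (case (x, y) of (x, z) \<Rightarrow> a x * (b (x +
      z) * r z)))"
      by (simp add: abs_mult[of "a _"])
    show "AE x in lborel. integrable lborel (\<lambda>y. case (x, y) of (x, z) \<Rightarrow> a x * (b (x + z) * r z))"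
      using in1 by simp
  qed measurable
  have e: "(LINT x|lborel. a x * (b (x + z) * r z)) = r z * corr a b z" for z
    unfolding corr_def integral_mult_right_zero[symmetric]
    by (rule Bochner_Integration.integral_cong) (auto simp: mult_ac)
  have "(LINT y|lborel. b y * r (y - x)) = (LINT z|lborel. b (x + z) * r z)" for x
    using lborel_integral_translation[of "\<lambda>y. b y * r (y - x)" x] by (simp add: add.commute)
  then show "(LINT x|lborel. a x * (LINT y|lborel. b y * r (y - x))) = (LINT z|lborel. r z * corr a b z)"
    using lborel_pair.Fubini_integral[OF p] by (simp add: e)
  show "integrable lborel (\<lambda>z. r z * corr a b z)"
    using lborel_pair.integrable_snd[OF p] by (simp add: e)
qed

lemma corr_measurable:
  assumes [measurable]: "a \<in> borel_measurable borel" "b \<in> borel_measurable borel"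
  shows "corr a b \<in> borel_measurable borel"
  unfolding corr_def[abs_def] by measurable

lemma corr_flip:
  assumes [measurable]: "a \<in> borel_measurable borel" "b \<in> borel_measurable borel"
  shows "corr a b z = corr b a (- z)"
  unfolding corr_def using lborel_integral_translation[of "\<lambda>x. b x * a (x - z)" z]
  by (simp add: mult.commute)

text \<open>Here the shifted factor is the integrable one and the fixed factor is bounded;
  reflecting \<open>z\<close> exchanges the roles. In the product rule this serves the term in which
  the derivative falls on the second function.\<close>

lemma isCont_corr':
  assumes "integrable lborel f" "a \<in> borel_measurable borel" "\<And>x. \<bar>a x\<bar> \<le> C"
  shows "isCont (corr a f) 0"
proof -
  have "corr a f z = corr f a (- z)" for z by (rule corr_flip) (use assms in auto)
  then have "corr a f = (\<lambda>z. corr f a (- z))" by blast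
  moreover have "isCont (\<lambda>z. corr f a (- z)) 0"
    by (rule isCont_o2[where g = "corr f a"]) (use isCont_corr[OF assms] in auto)
  ultimately show ?thesis by simp
qed

subsection \<open>Integrals against test functions and the fundamental lemma\<close>

lemma test_function_measurable:
  assumes "test_function S \<phi>"
  shows "\<phi> \<in> borel_measurable borel" "pd j \<phi> \<in> borel_measurable borel"
proof -
  have "C_k 0 \<phi>" "C_k 0 (pd j \<phi>)"
    using assms test_function_pd[OF assms] by (auto simp: test_function_def)
  then show "\<phi> \<in> borel_measurable borel" "pd j \<phi> \<in> borel_measurable borel"
    by (auto intro: borel_measurable_continuous_onI)
qed

lemma set_integral_test_function:
  assumes "test_function S \<phi>"
  shows "(LINT x:S|lebesgue. \<phi> x *\<^sub>R f x) = (LINT x|lebesgue. \<phi> x *\<^sub>R f x)"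
    "(LINT x:S|lebesgue. pd j \<phi> x *\<^sub>R f x) = (LINT x|lebesgue. pd j \<phi> x *\<^sub>R f x)"
proof -
  obtain K where K: "K \<subseteq> S" "\<And>x. \<phi> x \<noteq> 0 \<Longrightarrow> x \<in> K" "\<And>j x. pd j \<phi> x \<noteq> 0 \<Longrightarrow> x \<in> K"
    using test_functionE[OF assms] by metis
  have *: "indicator S x *\<^sub>R (\<phi> x *\<^sub>R f x) = \<phi> x *\<^sub>R f x" "indicator S x *\<^sub>R (pd j \<phi> x *\<^sub>R f x) =
    pd j \<phi> x *\<^sub>R f x" for x
    using K by (auto simp: indicator_def)
  show "(LINT x:S|lebesgue. \<phi> x *\<^sub>R f x) = (LINT x|lebesgue. \<phi> x *\<^sub>R f x)"
    "(LINT x:S|lebesgue. pd j \<phi> x *\<^sub>R f x) = (LINT x|lebesgue. pd j \<phi> x *\<^sub>R f x)"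
    unfolding set_lebesgue_integral_def * by simp_all
qed

lemma has_weak_pd_iff:
  "has_weak_pd S j f g \<longleftrightarrow> locally_integrable S f \<and> locally_integrable S g \<and>
     (\<forall>\<phi>. test_function S \<phi> \<longrightarrow> (LINT x|lebesgue. pd j \<phi> x *\<^sub>R f x) = - (LINT x|lebesgue. \<phi> x *\<^sub>R g x))"
  unfolding has_weak_pd_def by (auto simp: set_integral_test_function)

lemma has_weak_pdD:
  assumes "has_weak_pd S j f g" "test_function S \<phi>"
  shows "(LINT x|lebesgue. pd j \<phi> x *\<^sub>R f x) = - (LINT x|lebesgue. \<phi> x *\<^sub>R g x)"
  using assms unfolding has_weak_pd_iff by blast

section \<open>Localisation to compact sets and the fundamental lemma\<close>

lemma integrable_compact_support:
  assumes f: "locally_integrable S f" and K: "compact K" "K \<subseteq> S"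
    and \<phi>: "\<phi> \<in> borel_measurable lebesgue" "\<And>x. \<bar>\<phi> x\<bar> \<le> C" "\<And>x. \<phi> x \<noteq> 0 \<Longrightarrow> x \<in> K"
  shows "integrable lebesgue (\<lambda>x. \<phi> x *\<^sub>R f x)"
proof -
  have "integrable lebesgue (\<lambda>x. indicator K x *\<^sub>R f x)"
    using f K unfolding locally_integrable_def set_integrable_def by blast
  from integrable_scaleR_bounded[OF this \<phi>(1,2)]
  have "integrable lebesgue (\<lambda>x. \<phi> x *\<^sub>R (indicator K x *\<^sub>R f x))" .
  also have "(\<lambda>x. \<phi> x *\<^sub>R (indicator K x *\<^sub>R f x)) = (\<lambda>x. \<phi> x *\<^sub>R f x)"
  proof
    show "\<phi> x *\<^sub>R (indicator K x *\<^sub>R f x) = \<phi> x *\<^sub>R f x" for x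
      using \<phi>(3)[of x] by (cases "\<phi> x = 0") auto
  qed
  finally show ?thesis .
qed

lemma integrable_test_function:
  assumes f: "locally_integrable S f" and \<phi>: "test_function S \<phi>"
  shows "integrable lebesgue (\<lambda>x. \<phi> x *\<^sub>R f x)"
proof -
  obtain K where K: "\<And>k. C_k k \<phi>" "compact K" "K \<subseteq> S" "\<And>x. \<phi> x \<noteq> 0 \<Longrightarrow> x \<in> K"
    using test_functionE[OF \<phi>] by metis
  obtain C where C: "\<And>x. \<bar>\<phi> x\<bar> \<le> C"
    using continuous_compact_support_bounded[OF C_k_continuous[OF K(1)] K(2,4)] by metis
  show ?thesis
    by (rule integrable_compact_support[OF f K(2,3) _ C K(4)])
      (use test_function_measurable(1)[OF \<phi>] in \<open>auto intro: measurable_completion\<close>)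
qed

text \<open>Weak derivatives are stated with \<open>lebesgue\<close>, whereas Fubini and translation
  invariance are used for \<open>lborel\<close>. On a compact set the function is therefore
  exchanged for an integrable Borel function. The set \<open>V\<close> carries a bound along: it is
  a symmetric interval for bounded functions and \<open>UNIV\<close> otherwise.\<close>

lemma borel_representative:
  fixes f :: "real^'n::finite \<Rightarrow> real"
  assumes f: "locally_integrable S f" and K: "compact K" "K \<subseteq> S"
    and V: "\<And>x. x \<in> S \<Longrightarrow> f x \<in> V" "0 \<in> V" "V \<in> sets borel"
  obtains g where "integrable lborel g" "AE x in lebesgue. x \<in> K \<longrightarrow> g x = f x"
    "\<And>x. g x \<in> V"
    "\<And>\<phi>. \<phi> \<in> borel_measurable borel \<Longrightarrow> (\<And>x. \<phi> x \<noteq> 0 \<Longrightarrow> x \<in> K) \<Longrightarrow>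
      (LINT x|lebesgue. \<phi> x * f x) = (LINT x|lborel. \<phi> x * g x)"
proof -
  have i: "integrable lebesgue (\<lambda>x. indicator K x * f x)"
    using f K unfolding locally_integrable_def set_integrable_def by auto
  then obtain g0 where [measurable]: "g0 \<in> borel_measurable borel"
    and "AE x in lborel. indicator K x * f x = g0 x"
    using completion_ex_borel_measurable_real[of "\<lambda>x. indicator K x * f x" lborel] by auto
  then have ae: "AE x in lebesgue. indicator K x * f x = g0 x" by (intro AE_completion)
  have [measurable]: "K \<in> sets borel" "V \<in> sets borel" using K V borel_compact by auto
  \<comment> \<open>The Borel version leaves \<open>V\<close> at points of \<open>K\<close> only on
    a null set; putting 0 there makes the bound hold everywhere.\<close>
  define g where "g x = (if x \<in> K \<and> g0 x \<in> V then g0 x else 0)" for x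
  have gm[measurable]: "g \<in> borel_measurable borel" unfolding g_def[abs_def] by measurable
  have ae': "AE x in lebesgue. g x = indicator K x * f x"
  proof (rule eventually_mono[OF ae])
    fix x assume "indicator K x * f x = g0 x"
    then show "g x = indicator K x * f x"
      using V(1)[of x] K(2) by (cases "x \<in> K") (auto simp: g_def)
  qed
  have "integrable lebesgue g"
    using i by (rule integrable_cong_AE_imp) (use ae' in \<open>auto intro: measurable_completion elim: eventually_mono\<close>)
  then have gi: "integrable lborel g" by (subst (asm) integrable_completion) auto
  show thesis
  proof (rule that[OF gi])
    show "AE x in lebesgue. x \<in> K \<longrightarrow> g x = f x" using ae' by (rule eventually_mono) auto
    show "g x \<in> V" for x using V by (simp add: g_def)
    fix \<phi> :: "real^'n \<Rightarrow> real" assume \<phi>[measurable]: "\<phi> \<in> borel_measurable borel"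
      and z: "\<And>x. \<phi> x \<noteq> 0 \<Longrightarrow> x \<in> K"
    have e: "\<phi> x * f x = \<phi> x * (indicator K x * f x)" for x using z[of x] by (cases "\<phi> x = 0") auto
    have "(LINT x|lebesgue. \<phi> x * f x) = (LINT x|lebesgue. \<phi> x * (indicator K x * f x))"
      by (simp only: e[symmetric])
    also have "\<dots> = (LINT x|lebesgue. \<phi> x * g x)"
    proof (rule integral_cong_AE)
      show "AE x in lebesgue. \<phi> x * (indicator K x * f x) = \<phi> x * g x"
        using ae' by (rule eventually_mono) simp
      show "(\<lambda>x. \<phi> x * (indicator K x * f x)) \<in> borel_measurable lebesgue"
        by (rule borel_measurable_times[OF _ borel_measurable_integrable[OF i]])
          (auto intro: measurable_completion)
    qed (auto intro: measurable_completion)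
    also have "\<dots> = (LINT x|lborel. \<phi> x * g x)" by (rule integral_completion) auto
    finally show "(LINT x|lebesgue. \<phi> x * f x) = (LINT x|lborel. \<phi> x * g x)" .
  qed
qed

text \<open>The margin \<open>d\<close> is the room in which bumps centred at points of
  \<open>K\<close> remain test functions on \<open>S\<close>.\<close>

lemma compact_enlarge:
  fixes K :: "'a::euclidean_space set"
  assumes K: "compact K" "K \<subseteq> S" and S: "open S"
  obtains d K' where "d > 0" "compact K'" "K' \<subseteq> S" "\<And>x z. x \<in> K \<Longrightarrow> norm z \<le> d \<Longrightarrow> x + z \<in> K'"
proof -
  obtain d where d: "d > 0" "(\<Union>x\<in>K. cball x d) \<subseteq> S"
    using compact_subset_open_imp_cball_epsilon_subset[OF K(1) S K(2)] by auto
  let ?K = "{x + y | x y. x \<in> K \<and> y \<in> cball 0 d}"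
  have "compact ?K" using compact_sums[OF K(1) compact_cball] .
  moreover have "x + y \<in> S" if "x \<in> K" "norm y \<le> d" for x y
  proof -
    have "x + y \<in> cball x d" using that by (simp add: dist_norm)
    then show ?thesis using d(2) that(1) by blast
  qed
  then have "?K \<subseteq> S" by auto
  ultimately show thesis using that[OF d(1)] by fastforce
qed

lemma test_function_bump:
  assumes \<rho>: "\<And>k. C_k k \<rho>" "\<And>x. \<rho> x \<noteq> 0 \<Longrightarrow> norm x < d"
    and K': "compact K'" "K' \<subseteq> S" "\<And>z. norm z \<le> d \<Longrightarrow> x + z \<in> K'"
  shows "test_function S (\<lambda>y. \<rho> (y - x))"
proof (rule test_functionI[OF _ K'(1,2)])
  show "C_k k (\<lambda>y. \<rho> (y - x))" for k using C_k_translate[of k \<rho> "- x"] \<rho>(1) by simp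
  show "y \<in> K'" if "\<rho> (y - x) \<noteq> 0" for y using K'(3)[of "y - x"] \<rho>(2)[OF that] by simp
qed

text \<open>Correlate \<open>\<psi>\<close>, the sign of \<open>F\<close> cut off to
  \<open>K\<close>, with \<open>F\<close>: the value at 0 is the integral of
  \<open>\<bar>F\<bar>\<close> over \<open>K\<close>. Against a bump \<open>\<rho>\<close> the
  correlation integrates to 0, since for each \<open>x\<close> in \<open>K\<close> the translate
  \<open>\<rho> (y - x)\<close> is an admissible test function in \<open>y\<close>.\<close>

lemma fundamental_lemma_compact:
  fixes f :: "real^'n::finite \<Rightarrow> real"
  assumes S: "open S" and f: "locally_integrable S f" and K: "compact K" "K \<subseteq> S"
    and zero: "\<And>\<phi>. test_function S \<phi> \<Longrightarrow> (LINT x|lebesgue. \<phi> x * f x) = 0"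
  shows "AE x in lebesgue. x \<in> K \<longrightarrow> f x = 0"
proof -
  obtain d K' where d: "d > 0" and K': "compact K'" "K' \<subseteq> S" "\<And>x z. x \<in> K \<Longrightarrow> norm z \<le> d \<Longrightarrow> x + z \<in> K'"
    using compact_enlarge[OF K S] by metis
  have KK': "K \<subseteq> K'" using K'(3)[of _ 0] d by auto
  obtain F where F: "integrable lborel F" "AE x in lebesgue. x \<in> K' \<longrightarrow> F x = f x"
    and Fint: "\<And>\<phi>. \<phi> \<in> borel_measurable borel \<Longrightarrow> (\<And>x. \<phi> x \<noteq> 0 \<Longrightarrow> x \<in> K') \<Longrightarrow>
      (LINT x|lebesgue. \<phi> x * f x) = (LINT x|lborel. \<phi> x * F x)"
    using borel_representative[OF f K'(1,2), of UNIV] by auto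
  have [measurable]: "F \<in> borel_measurable borel" "K \<in> sets borel" using F K borel_compact by auto
  define \<psi> where "\<psi> x = indicator K x * sgn (F x)" for x
  have \<psi>[measurable]: "\<psi> \<in> borel_measurable borel" unfolding \<psi>_def[abs_def] by measurable
  have \<psi>1: "\<bar>\<psi> x\<bar> \<le> 1" for x by (auto simp: \<psi>_def indicator_def sgn_if)
  have "integrable lborel (indicator K :: _ \<Rightarrow> real)"
    using emeasure_compact_finite[OF K(1)] by (intro integrable_real_indicator) auto
  then have \<psi>i: "integrable lborel \<psi>"
    unfolding \<psi>_def[abs_def] by (rule integrable_mult_bounded[of _ _ _ 1]) (auto simp: sgn_if)
  have "corr \<psi> F 0 = 0"
  proof (rule zero_of_bump_integrals[OF corr_measurable isCont_corr'[OF F(1) \<psi> \<psi>1] d])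
    fix \<rho> :: "real^'n \<Rightarrow> real" assume \<rho>: "\<And>k. C_k k \<rho>" "\<And>x. \<rho> x \<noteq> 0 \<Longrightarrow> norm x < d"
    have c: "continuous_on UNIV \<rho>" using \<rho>(1) C_k_continuous by blast
    then have [measurable]: "\<rho> \<in> borel_measurable borel" by (rule borel_measurable_continuous_onI)
    obtain C where C: "\<And>x. \<bar>\<rho> x\<bar> \<le> C"
      using continuous_compact_support_bounded[OF c compact_cball[of 0 d]] \<rho>(2)
        by (metis dist_0_norm less_imp_le mem_cball)
    have eq0: "\<psi> x * (LINT y|lborel. F y * \<rho> (y - x)) = 0" for x
    proof (cases "x \<in> K")
      case True
      have t: "test_function S (\<lambda>y. \<rho> (y - x))"
        by (rule test_function_bump[OF \<rho> K'(1,2)]) (use K'(3) True in auto)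
      have "(LINT y|lborel. \<rho> (y - x) * F y) = (LINT y|lebesgue. \<rho> (y - x) * f y)"
        by (rule Fint[symmetric]) (use \<rho>(2) K'(3)[OF True, of "_ - x"] in \<open>auto simp: less_imp_le\<close>)
      then show ?thesis using zero[OF t] by (simp add: mult.commute)
    qed (simp add: \<psi>_def)
    have "(LINT z|lborel. \<rho> z * corr \<psi> F z) = (LINT x|lborel. \<psi> x * (LINT y|lborel. F y * \<rho> (y - x)))"
      by (rule conv_eq_corr(1)[OF \<psi>i F(1) _ C, symmetric]) simp
    also have "\<dots> = 0" unfolding eq0 by simp
    finally show "(LINT z|lborel. \<rho> z * corr \<psi> F z) = 0" .
  qed auto
  then have "(LINT x|lborel. indicator K x * \<bar>F x\<bar>) = 0"
    by (simp add: corr_def \<psi>_def mult.assoc) (simp add: abs_sgn mult.commute)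
  moreover have "integrable lborel (\<lambda>x. indicator K x * \<bar>F x\<bar>)"
    using integrable_mult_bounded[of lborel "\<lambda>x. \<bar>F x\<bar>" "indicator K" 1] F(1) by (simp add: mult.commute)
  ultimately have "AE x in lborel. indicator K x * \<bar>F x\<bar> = 0"
    by (subst (asm) integral_nonneg_eq_0_iff_AE) auto
  then have "AE x in lebesgue. indicator K x * \<bar>F x\<bar> = 0" by (rule AE_completion)
  with F(2) show ?thesis by eventually_elim (use KK' in auto)
qed

lemma fundamental_lemma:
  fixes f :: "real^'n::finite \<Rightarrow> real"
  assumes S: "open S" and f: "locally_integrable S f"
    and zero: "\<And>\<phi>. test_function S \<phi> \<Longrightarrow> (LINT x|lebesgue. \<phi> x * f x) = 0"
  shows "AE x in lebesgue. x \<in> S \<longrightarrow> f x = 0"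
proof -
  obtain C :: "nat \<Rightarrow> (real^'n) set" where C: "\<And>n. compact (C n)" "\<And>n. C n \<subseteq> S" "(\<Union>n. C n) = S"
    using open_Union_compact_subsets[OF S] by metis
  have "AE x in lebesgue. \<forall>n. x \<in> C n \<longrightarrow> f x = 0"
    unfolding AE_all_countable using fundamental_lemma_compact[OF S f C(1,2) zero] by blast
  then show ?thesis by (rule eventually_mono) (use C(3) in blast)
qed

subsection \<open>The product rule for bounded weakly differentiable functions\<close>

lemma locally_integrable_add:
  "locally_integrable S f \<Longrightarrow> locally_integrable S g \<Longrightarrow> locally_integrable S (\<lambda>x. f x + g x)"
  unfolding locally_integrable_def by (blast intro: set_integral_add)

lemma locally_integrable_mult_bounded:
  fixes f g :: "real^'n::finite \<Rightarrow> real"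
  assumes f: "locally_integrable S f" and g: "locally_integrable S g"
    and C: "\<And>x. x \<in> S \<Longrightarrow> \<bar>g x\<bar> \<le> C" "C \<ge> 0"
  shows "locally_integrable S (\<lambda>x. f x * g x)"
  unfolding locally_integrable_def
proof (intro allI impI)
  fix K assume K: "compact K \<and> K \<subseteq> S"
  then have i: "integrable lebesgue (\<lambda>x. indicator K x * f x)"
    "integrable lebesgue (\<lambda>x. indicator K x * g x)"
    using f g unfolding locally_integrable_def set_integrable_def by auto
  have "integrable lebesgue (\<lambda>x. (indicator K x * f x) * (indicator K x * g x))"
    by (rule integrable_mult_bounded[OF i(1) borel_measurable_integrable[OF i(2)], of C])
      (use C K in \<open>auto simp: indicator_def\<close>)
  also have "(\<lambda>x. (indicator K x * f x) * (indicator K x * g x)) = (\<lambda>x. indicator K x *\<^sub>R (f x * g x))"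
    by (auto simp: indicator_def)
  finally show "(\<lambda>x. f x * g x) absolutely_integrable_on K" by (simp add: set_integrable_def)
qed

text \<open>No mollification of \<open>u\<close> or \<open>w\<close> is needed: the test function \<open>\<phi>(x) \<rho>(y - x)\<close> is inserted into the
  equation for \<open>u\<close>, the result is integrated against \<open>w(y)\<close>, and the derivative that falls on \<open>\<rho>\<close> is
  moved to \<open>w\<close>.  With \<open>y = x + z\<close> this says that \<open>\<rho>\<close> is orthogonal to a sum \<open>R\<close> of correlations whose
  value at \<open>z = 0\<close> is the left-hand side below.\<close>

lemma weak_product_integral:
  fixes u w :: "real^'n::finite \<Rightarrow> real"
  assumes S: "open S" and u: "has_weak_pd S j u u'" and w: "has_weak_pd S j w w'"
    and C: "\<And>x. x \<in> S \<Longrightarrow> \<bar>u x\<bar> \<le> C" "\<And>x. x \<in> S \<Longrightarrow> \<bar>w x\<bar> \<le> C" "C \<ge> 0"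
    and \<phi>: "test_function S \<phi>"
  shows "(LINT x|lebesgue. pd j \<phi> x * (u x * w x)) + (LINT x|lebesgue. \<phi> x * (u x * w' x))
           + (LINT x|lebesgue. \<phi> x * (u' x * w x)) = 0"
proof -
  have loc: "locally_integrable S u" "locally_integrable S u'" "locally_integrable S w"
    "locally_integrable S w'"
    using u w unfolding has_weak_pd_def by blast+
  obtain K where K: "\<And>k. C_k k \<phi>" "compact K" "K \<subseteq> S" "\<And>x. \<phi> x \<noteq> 0 \<Longrightarrow> x \<in> K"
    "\<And>j x. pd j \<phi> x \<noteq> 0 \<Longrightarrow> x \<in> K"
    using test_functionE[OF \<phi>] by metis
  obtain d K' where d: "d > 0" and K': "compact K'" "K' \<subseteq> S" "\<And>x z. x \<in> K \<Longrightarrow> norm z \<le> d \<Longrightarrow> x + z \<in> K'"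
    using compact_enlarge[OF K(2,3) S] by metis
  have KK': "x \<in> K'" if "x \<in> K" for x using K'(3)[OF that, of 0] d by auto
  note [measurable] = test_function_measurable[OF \<phi>]
  obtain c0 where c0: "\<And>x. \<bar>\<phi> x\<bar> \<le> c0"
    using continuous_compact_support_bounded[OF C_k_continuous[OF K(1)] K(2,4)] by metis
  have "C_k 0 (pd j \<phi>)" using K(1)[of 1] by simp
  then obtain c1 where c1: "\<And>x. \<bar>pd j \<phi> x\<bar> \<le> c1"
    using continuous_compact_support_bounded[OF C_k_continuous[of 0 "pd j \<phi>"] K(2) K(5)[of j]] by metis
  let ?V = "{-C..C}"
  have V: "x \<in> S \<Longrightarrow> u x \<in> ?V" "x \<in> S \<Longrightarrow> w x \<in> ?V" "0 \<in> ?V" "?V \<in> sets borel" for x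
    using C(1,2)[of x] C(3) by (auto simp: abs_le_iff)
  note rep = borel_representative[OF _ K'(1,2)]
  obtain U where U: "integrable lborel U" "AE x in lebesgue. x \<in> K' \<longrightarrow> U x = u x" "\<And>x. U x \<in> ?V"
    and Uint: "\<And>\<phi>. \<phi> \<in> borel_measurable borel \<Longrightarrow> (\<And>x. \<phi> x \<noteq> 0 \<Longrightarrow> x \<in> K') \<Longrightarrow>
      (LINT x|lebesgue. \<phi> x * u x) = (LINT x|lborel. \<phi> x * U x)"
    using rep[OF loc(1) V(1,3,4)] by blast
  obtain U' where U': "integrable lborel U'" "AE x in lebesgue. x \<in> K' \<longrightarrow> U' x = u' x"
    and U'int: "\<And>\<phi>. \<phi> \<in> borel_measurable borel \<Longrightarrow> (\<And>x. \<phi> x \<noteq> 0 \<Longrightarrow> x \<in> K') \<Longrightarrow>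
      (LINT x|lebesgue. \<phi> x * u' x) = (LINT x|lborel. \<phi> x * U' x)"
    using rep[OF loc(2), of UNIV] by auto
  obtain W where W: "integrable lborel W" "AE x in lebesgue. x \<in> K' \<longrightarrow> W x = w x" "\<And>x. W x \<in> ?V"
    and Wint: "\<And>\<phi>. \<phi> \<in> borel_measurable borel \<Longrightarrow> (\<And>x. \<phi> x \<noteq> 0 \<Longrightarrow> x \<in> K') \<Longrightarrow>
      (LINT x|lebesgue. \<phi> x * w x) = (LINT x|lborel. \<phi> x * W x)"
    using rep[OF loc(3) V(2,3,4)] by blast
  obtain W' where W': "integrable lborel W'" "AE x in lebesgue. x \<in> K' \<longrightarrow> W' x = w' x"
    and W'int: "\<And>\<phi>. \<phi> \<in> borel_measurable borel \<Longrightarrow> (\<And>x. \<phi> x \<noteq> 0 \<Longrightarrow> x \<in> K') \<Longrightarrow>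
      (LINT x|lebesgue. \<phi> x * w' x) = (LINT x|lborel. \<phi> x * W' x)"
    using rep[OF loc(4), of UNIV] by auto
  have [measurable]: "U \<in> borel_measurable borel" "U' \<in> borel_measurable borel"
      "W \<in> borel_measurable borel" "W' \<in> borel_measurable borel" using U U' W W' by auto
  have UC: "\<bar>U x\<bar> \<le> C" and WC: "\<bar>W x\<bar> \<le> C" for x using U(3)[of x] W(3)[of x] by (auto simp: abs_le_iff)
  \<comment> \<open>These are the parts of the three integrands that stay at the point
    \<open>x\<close>; \<open>W\<close> or \<open>W'\<close> is evaluated at
    \<open>x + z\<close>.\<close>
  define a1 a2 a3 where "a1 x = U x * pd j \<phi> x" and "a2 x = U x * \<phi> x" and "a3 x = U' x * \<phi> x" for x
  have a: "integrable lborel a1" "integrable lborel a2" "integrable lborel a3"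
    unfolding a1_def[abs_def] a2_def[abs_def] a3_def[abs_def]
    by (auto intro!: integrable_mult_bounded[OF U(1) _ c0] integrable_mult_bounded[OF U(1) _ c1]
      integrable_mult_bounded[OF U'(1) _ c0])
  have [measurable]: "a1 \<in> borel_measurable borel" "a2 \<in> borel_measurable borel"
    "a3 \<in> borel_measurable borel"
    using a by auto
  have a2b: "\<bar>a2 x\<bar> \<le> C * c0" for x
    unfolding a2_def abs_mult by (intro mult_mono UC c0) (use C(3) in auto)
  define R where "R z = corr a1 W z + corr a2 W' z + corr a3 W z" for z
  have "R 0 = 0"
  proof (rule zero_of_bump_integrals[OF _ _ d])
    show "R \<in> borel_measurable borel" unfolding R_def[abs_def]
      by (intro borel_measurable_add corr_measurable) measurable
    \<comment> \<open>In the first and third terms the shifted function \<open>W\<close> is bounded.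
      In the second \<open>W'\<close> is merely integrable, but \<open>a2\<close> is
      bounded.\<close>
    show "isCont R 0" unfolding R_def[abs_def]
      by (intro isCont_add isCont_corr[OF a(1) _ WC] isCont_corr[OF a(3) _ WC]
        isCont_corr'[OF W'(1) _ a2b]) auto
    fix \<rho> :: "real^'n \<Rightarrow> real" assume \<rho>: "\<And>k. C_k k \<rho>" "\<And>x. \<rho> x \<noteq> 0 \<Longrightarrow> norm x < d"
    have \<rho>1: "C_k (Suc 0) \<rho>" by (rule \<rho>)
    have tr: "test_function (ball 0 (d + 1)) \<rho>"
      by (rule test_functionI[OF \<rho>(1) compact_cball[of 0 d]]) (use \<rho>(2) in \<open>auto simp: less_imp_le\<close>)
    note \<rho>m[measurable] = test_function_measurable(1)[OF tr]
      and \<rho>m'[measurable] = test_function_measurable(2)[OF tr, of j]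
    have z: "norm x \<le> d" if "\<rho> x \<noteq> 0 \<or> pd j \<rho> x \<noteq> 0" for x
      using that \<rho>(2)[of x] pd_support[of "cball 0 d" \<rho> j x] \<rho>(2) by (force simp: less_imp_le)
    obtain b0 where b0: "\<And>x. \<bar>\<rho> x\<bar> \<le> b0"
      using continuous_compact_support_bounded[OF C_k_continuous[OF \<rho>(1)] compact_cball[of 0 d]] z
        by (metis mem_cball dist_0_norm)
    have "C_k 0 (pd j \<rho>)" using \<rho>(1)[of 1] by simp
    then obtain b1 where b1: "\<And>x. \<bar>pd j \<rho> x\<bar> \<le> b1"
      using continuous_compact_support_bounded[OF C_k_continuous[of 0 "pd j \<rho>"]
        compact_cball[of 0 d]] z by (metis mem_cball dist_0_norm)
    let ?I = "\<lambda>a b r. LINT y|lborel. b y * (LINT x|lborel. a x * r (y - x))"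
    have I: "?I a b r = (LINT z|lborel. r z * corr a b z)"
      if "integrable lborel a" "integrable lborel b" "r \<in> borel_measurable borel" "\<And>x. \<bar>r x\<bar> \<le> c"
        for a b r c
      using conv_swap(1)[OF that] conv_eq_corr(1)[OF that] by simp
    \<comment> \<open>This is the weak equation of \<open>u\<close> for the test function
      \<open>\<phi> x * \<rho> (y - x)\<close>; the minus sign comes from the reflected argument of
      \<open>\<rho>\<close>.\<close>
    have E1: "(LINT x|lborel. a1 x * \<rho> (y - x)) - (LINT x|lborel. a2 x * pd j \<rho> (y - x)) +
      (LINT x|lborel. a3 x * \<rho> (y - x)) = 0" for y
    proof -
      let ?\<psi> = "\<lambda>x. \<phi> x * \<rho> (y - x)"
      have t: "test_function S ?\<psi>" by (rule test_function_mult[OF \<phi>]) (rule C_k_reflect[OF \<rho>(1)])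
      have p: "pd j ?\<psi> x = pd j \<phi> x * \<rho> (y - x) - \<phi> x * pd j \<rho> (y - x)" for x
        using pd_mult[OF K(1) C_k_reflect[OF \<rho>1, of y], where j = j
          and x = x] pd_reflect[OF \<rho>1, where j = j and x = x and y = y] by simp
      have sup: "x \<in> K'" if "?\<psi> x \<noteq> 0 \<or> pd j ?\<psi> x \<noteq> 0" for x
      proof (rule ccontr)
        assume "x \<notin> K'"
        then have "\<phi> x = 0" "pd j \<phi> x = 0" using K(4)[of x] K(5)[of j x] KK'[of x] by blast+
        then show False using that unfolding p by simp
      qed
      have [measurable]: "pd j ?\<psi> \<in> borel_measurable borel" using test_function_measurable(2)[OF t] .
      have "(LINT x|lborel. pd j ?\<psi> x * U x) = - (LINT x|lborel. ?\<psi> x * U' x)"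
        using has_weak_pdD[OF u t] Uint[of "pd j ?\<psi>"] U'int[of ?\<psi>] sup by simp
      moreover have "(LINT x|lborel. ?\<psi> x * U' x) = (LINT x|lborel. a3 x * \<rho> (y - x))"
        by (simp add: a3_def mult_ac)
      moreover have "(LINT x|lborel. pd j ?\<psi> x * U x) =
        (LINT x|lborel. a1 x * \<rho> (y - x) - a2 x * pd j \<rho> (y - x))"
        unfolding p a1_def a2_def by (simp add: algebra_simps)
      moreover have "\<dots> = (LINT x|lborel. a1 x * \<rho> (y - x)) - (LINT x|lborel. a2 x * pd j \<rho> (y - x))"
        by (intro Bochner_Integration.integral_diff integrable_mult_bounded[OF a(1)]
          integrable_mult_bounded[OF a(2)])
          (use b0 b1 in auto)
      ultimately show ?thesis by linarith
    qed
    have "?I a1 W \<rho> - ?I a2 W (pd j \<rho>) + ?I a3 W \<rho>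
        = (LINT y|lborel. W y * ((LINT x|lborel. a1 x * \<rho> (y - x)) - (LINT x|lborel. a2 x * pd j \<rho>
          (y - x)) + (LINT x|lborel. a3 x * \<rho> (y - x))))"
      using conv_swap(2)[OF a(1) W(1) \<rho>m b0] conv_swap(2)[OF a(2) W(1) \<rho>m' b1]
        conv_swap(2)[OF a(3) W(1) \<rho>m b0]
      by (simp add: distrib_left right_diff_distrib)
    also have "\<dots> = 0" unfolding E1 by simp
    finally have F1: "?I a1 W \<rho> - ?I a2 W (pd j \<rho>) + ?I a3 W \<rho> = 0" .
    \<comment> \<open>This is the weak equation of \<open>w\<close> in the variable
      \<open>y\<close>. The bump around \<open>x\<close> is admissible for \<open>x\<close> in
      \<open>K\<close>, and for other \<open>x\<close> the factor \<open>a2 x\<close>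
      vanishes.\<close>
    have E2: "a2 x * (LINT y|lborel. W y * pd j \<rho> (y - x)) =
      - (a2 x * (LINT y|lborel. W' y * \<rho> (y - x)))" for x
    proof (cases "x \<in> K")
      case True
      let ?\<psi> = "\<lambda>y. \<rho> (y - x)"
      have t: "test_function S ?\<psi>"
        by (rule test_function_bump[OF \<rho> K'(1,2)]) (use K'(3) True in auto)
      have p: "pd j ?\<psi> = (\<lambda>y. pd j \<rho> (y - x))"
        using pd_translate[OF \<rho>1, where j = j and y = "- x"] by auto
      have sup: "y \<in> K'" if "\<rho> (y - x) \<noteq> 0 \<or> pd j \<rho> (y - x) \<noteq> 0" for y
        using K'(3)[OF True, of "y - x"] z[OF that] by simp
      have "(LINT y|lborel. pd j \<rho> (y - x) * W y) = - (LINT y|lborel. \<rho> (y - x) * W' y)"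
        using has_weak_pdD[OF w t] Wint[of "pd j ?\<psi>"] W'int[of ?\<psi>] sup unfolding p by simp
      then show ?thesis by (simp add: mult.commute)
    next
      case False
      then have "\<phi> x = 0" using K(4) by blast
      then show ?thesis by (simp add: a2_def)
    qed
    have "?I a2 W (pd j \<rho>) = (LINT x|lborel. a2 x * (LINT y|lborel. W y * pd j \<rho> (y - x)))"
      by (rule conv_swap(1)[OF a(2) W(1) \<rho>m' b1])
    also have "\<dots> = - (LINT x|lborel. a2 x * (LINT y|lborel. W' y * \<rho> (y - x)))"
      unfolding E2 by simp
    also have "\<dots> = - ?I a2 W' \<rho>"
      using conv_swap(1)[OF a(2) W'(1) \<rho>m b0] by simp
    finally have F2: "?I a1 W \<rho> + ?I a2 W' \<rho> + ?I a3 W \<rho> = 0" using F1 by simp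
    have ci: "integrable lborel (\<lambda>z. \<rho> z * corr a1 W z)" "integrable lborel (\<lambda>z. \<rho> z * corr a2 W' z)"
        "integrable lborel (\<lambda>z. \<rho> z * corr a3 W z)"
      using conv_eq_corr(2)[OF a(1) W(1) \<rho>m b0] conv_eq_corr(2)[OF a(2) W'(1) \<rho>m b0]
        conv_eq_corr(2)[OF a(3) W(1) \<rho>m b0]
      by simp_all
    have "(LINT z|lborel. \<rho> z * R z) = ?I a1 W \<rho> + ?I a2 W' \<rho> + ?I a3 W \<rho>"
      using I[OF a(1) W(1) \<rho>m b0] I[OF a(2) W'(1) \<rho>m b0] I[OF a(3) W(1) \<rho>m b0] ci
      by (simp add: R_def distrib_left)
    with F2 show "(LINT z|lborel. \<rho> z * R z) = 0" by simp
  qed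
  then have R0: "(LINT x|lborel. a1 x * W x) + (LINT x|lborel. a2 x * W' x) +
    (LINT x|lborel. a3 x * W x) = 0"
    by (simp add: R_def corr_def)
  \<comment> \<open>Return from the Borel representatives to the original functions: the weight
    \<open>\<xi>\<close> lives on \<open>K\<close>, where both agree almost everywhere.\<close>
  have eq: "(LINT x|lebesgue. \<xi> x * (f x * g x)) = (LINT x|lborel. F x * \<xi> x * G x)"
    if \<xi>[measurable]: "\<xi> \<in> borel_measurable borel" "\<And>x. \<xi> x \<noteq> 0 \<Longrightarrow> x \<in> K"
      and f: "locally_integrable S f" "AE x in lebesgue. x \<in> K' \<longrightarrow> F x = f x"
      and g: "locally_integrable S g" "AE x in lebesgue. x \<in> K' \<longrightarrow> G x = g x"
      and [measurable]: "F \<in> borel_measurable borel" "G \<in> borel_measurable borel"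
    for \<xi> f g F G :: "real^'n \<Rightarrow> real"
  proof -
    have i: "integrable lebesgue (\<lambda>x. indicator K' x * f x)"
      "integrable lebesgue (\<lambda>x. indicator K' x * g x)"
      using f g K' unfolding locally_integrable_def set_integrable_def by auto
    have \<xi>m: "\<xi> \<in> borel_measurable lebesgue" by (auto intro: measurable_completion)
    have e: "\<xi> x * (f x * g x) = \<xi> x * ((indicator K' x * f x) * (indicator K' x * g x))" for x
      using that(2)[of x] KK'[of x] by (cases "\<xi> x = 0") auto
    have "(LINT x|lebesgue. \<xi> x * (f x * g x)) = (LINT x|lebesgue. F x * \<xi> x * G x)"
    proof (rule integral_cong_AE)
      show "(\<lambda>x. \<xi> x * (f x * g x)) \<in> borel_measurable lebesgue"
        unfolding e by (intro borel_measurable_times \<xi>m borel_measurable_integrable[OF i(1)]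
          borel_measurable_integrable[OF i(2)])
      show "AE x in lebesgue. \<xi> x * (f x * g x) = F x * \<xi> x * G x"
        using f(2) g(2)
      proof eventually_elim
        case (elim x)
        then show ?case using that(2)[of x] KK'[of x] by (cases "\<xi> x = 0") auto
      qed
    qed (auto intro: measurable_completion)
    also have "\<dots> = (LINT x|lborel. F x * \<xi> x * G x)" by (rule integral_completion) auto
    finally show ?thesis .
  qed
  have "(LINT x|lebesgue. pd j \<phi> x * (u x * w x)) = (LINT x|lborel. a1 x * W x)"
    unfolding a1_def by (rule eq[OF _ K(5) loc(1) U(2) loc(3) W(2)]) measurable
  moreover have "(LINT x|lebesgue. \<phi> x * (u x * w' x)) = (LINT x|lborel. a2 x * W' x)"
    unfolding a2_def by (rule eq[OF _ K(4) loc(1) U(2) loc(4) W'(2)]) measurable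
  moreover have "(LINT x|lebesgue. \<phi> x * (u' x * w x)) = (LINT x|lborel. a3 x * W x)"
    unfolding a3_def by (rule eq[OF _ K(4) loc(2) U'(2) loc(3) W(2)]) measurable
  ultimately show ?thesis using R0 by simp
qed

subsection \<open>Difference quotients and mixed weak derivatives\<close>

lemma axis_has_real_derivative:
  fixes \<phi> :: "real^'n::finite \<Rightarrow> real"
  assumes "C_k (Suc 0) \<phi>"
  shows "((\<lambda>t. \<phi> (x + t *\<^sub>R axis j 1)) has_real_derivative pd j \<phi> (x + t *\<^sub>R axis j 1)) (at t)"
proof -
  let ?D = "frechet_derivative \<phi> (at (x + t *\<^sub>R axis j 1))"
  have d: "(\<phi> has_derivative ?D) (at (x + t *\<^sub>R axis j 1))" by (rule C_k_Suc_has_derivative[OF assms])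
  have "((\<lambda>t. \<phi> (x + t *\<^sub>R axis j 1)) has_derivative (\<lambda>h. ?D (h *\<^sub>R axis j 1))) (at t)"
    by (rule has_derivative_compose[of "\<lambda>t. x + t *\<^sub>R axis j 1" "\<lambda>h. h *\<^sub>R axis j 1" t UNIV \<phi>, OF _ d])
      (auto intro!: derivative_eq_intros)
  also have "(\<lambda>h. ?D (h *\<^sub>R axis j 1)) = (*) (pd j \<phi> (x + t *\<^sub>R axis j 1))"
    using linear_scale[OF has_derivative_linear[OF d]] by (auto simp: pd_def)
  finally show ?thesis by (simp add: has_field_derivative_def)
qed

text \<open>The difference is written as a sum with the factor -1 so that the closure rules for
  constants, products, sums and translates apply to it literally.\<close>

definition diff_quot :: "'n::finite \<Rightarrow> real \<Rightarrow> (real^'n \<Rightarrow> real) \<Rightarrow> real^'n \<Rightarrow> real" where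
  "diff_quot j h \<phi> x = (1/h) * (\<phi> (x + h *\<^sub>R axis j 1) + (-1) * \<phi> x)"

lemma C_k_diff_quot: "C_k k \<phi> \<Longrightarrow> C_k k (diff_quot j h \<phi>)"
  unfolding diff_quot_def[abs_def] by (intro C_k_mult C_k_const C_k_add C_k_translate)

lemma pd_diff_quot:
  assumes "C_k (Suc 0) \<phi>"
  shows "pd i (diff_quot j h \<phi>) = diff_quot j h (pd i \<phi>)"
proof
  fix x
  let ?a = "h *\<^sub>R axis j 1"
  have "((\<lambda>x. \<phi> (x + ?a)) has_derivative frechet_derivative (\<lambda>x. \<phi> (x + ?a)) (at x)) (at x)"
    by (rule C_k_Suc_has_derivative[OF C_k_translate[OF assms]])
  then have "(diff_quot j h \<phi> has_derivative (\<lambda>y. (1/h) * (frechet_derivative (\<lambda>x. \<phi> (x +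
    ?a)) (at x) y + (-1) * frechet_derivative \<phi> (at x) y))) (at x)"
    unfolding diff_quot_def[abs_def]
    by (intro has_derivative_mult_right has_derivative_add C_k_Suc_has_derivative[OF assms])
  from pd_eqI[OF this] show "pd i (diff_quot j h \<phi>) x = diff_quot j h (pd i \<phi>) x"
    using pd_translate[OF assms, where j = i and y = ?a and x = x] by (simp add: diff_quot_def pd_def)
qed

text \<open>The mean value theorem along the axis gives a bound independent of \<open>h\<close>,
  which serves as the dominating constant in the limit.\<close>

lemma diff_quot_bounded:
  assumes \<phi>: "C_k (Suc 0) \<phi>" and h: "h > 0" and C: "\<And>x. \<bar>pd j \<phi> x\<bar> \<le> C"
  shows "\<bar>diff_quot j h \<phi> x\<bar> \<le> C"
proof -
  obtain z where "\<phi> (x + h *\<^sub>R axis j 1) - \<phi> (x + 0 *\<^sub>R axis j 1) = (h - 0) * pd j \<phi> (x +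
    z *\<^sub>R axis j 1)"
    using MVT2[OF h, of "\<lambda>t. \<phi> (x + t *\<^sub>R axis j 1)" "\<lambda>t. pd j \<phi> (x + t *\<^sub>R axis j 1)"]
      axis_has_real_derivative[OF \<phi>] by blast
  then have "diff_quot j h \<phi> x = pd j \<phi> (x + z *\<^sub>R axis j 1)" using h by (simp add: diff_quot_def)
  then show ?thesis using C by simp
qed

lemma diff_quot_tendsto:
  assumes "C_k (Suc 0) \<phi>" and h: "h \<longlonglongrightarrow> 0" "\<And>n. h n \<noteq> 0"
  shows "(\<lambda>n. diff_quot j (h n) \<phi> x) \<longlonglongrightarrow> pd j \<phi> x"
proof -
  have "((\<lambda>t. (\<phi> (x + t *\<^sub>R axis j 1) - \<phi> x) / t) \<longlongrightarrow> pd j \<phi> x) (at 0)"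
    using axis_has_real_derivative[OF assms(1), of x j 0] by (simp add: DERIV_def)
  moreover have "filterlim h (at 0) sequentially" using h by (simp add: filterlim_at)
  ultimately have "(\<lambda>n. (\<phi> (x + h n *\<^sub>R axis j 1) - \<phi> x) / h n) \<longlonglongrightarrow> pd j \<phi> x"
    by (rule filterlim_compose)
  then show ?thesis by (simp add: diff_quot_def)
qed

definition smooth_on_supp :: "(real^'n::finite) set \<Rightarrow> (real^'n \<Rightarrow> real) \<Rightarrow> bool" where
  "smooth_on_supp K \<psi> \<longleftrightarrow> (\<forall>k. C_k k \<psi>) \<and> (\<forall>x. \<psi> x \<noteq> 0 \<longrightarrow> x \<in> K)"

text \<open>The steps \<open>h n\<close> depend only on \<open>K\<close> and \<open>S\<close>, so
  one sequence can be used for both \<open>\<phi>\<close> and \<open>pd k \<phi>\<close>. They are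
  at most the margin \<open>d\<close>, which keeps the supports of all quotients in one compact
  subset of \<open>S\<close>.\<close>

lemma diff_quot_approx:
  fixes S :: "(real^'n::finite) set"
  assumes S: "open S" and K: "compact K" "K \<subseteq> S"
  obtains h where "\<forall>\<psi> n. smooth_on_supp K \<psi> \<longrightarrow> test_function S (diff_quot j (h n) \<psi>)"
    "\<forall>\<psi> f. smooth_on_supp K \<psi> \<longrightarrow> locally_integrable S f \<longrightarrow>
       (\<lambda>n. LINT x|lebesgue. diff_quot j (h n) \<psi> x * f x) \<longlonglongrightarrow> (LINT x|lebesgue. pd j \<psi> x * f x)"
proof -
  obtain d K' where d: "d > 0" and K': "compact K'" "K' \<subseteq> S" "\<And>x z. x \<in> K \<Longrightarrow> norm z \<le> d \<Longrightarrow> x + z \<in> K'"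
    using compact_enlarge[OF K S] by metis
  define h where "h n = d / real (Suc n)" for n
  have h0: "h n > 0" and hd: "h n \<le> d" for n
    using d by (auto simp: h_def field_simps mult_le_cancel_left1)
  have hl: "h \<longlonglongrightarrow> 0" unfolding h_def using tendsto_mult_right_zero[OF LIMSEQ_inverse_real_of_nat, of d]
    by (simp add: divide_inverse)
  have sup: "x \<in> K'" if "diff_quot j (h n) \<psi> x \<noteq> 0" and \<psi>: "\<And>x. \<psi> x \<noteq> 0 \<Longrightarrow> x \<in> K" for \<psi> x n
  proof -
    have "\<psi> x \<noteq> 0 \<or> \<psi> (x + h n *\<^sub>R axis j 1) \<noteq> 0" using that(1) by (auto simp: diff_quot_def)
    then consider "x \<in> K" | "x + h n *\<^sub>R axis j 1 \<in> K" using \<psi> by blast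
    then show ?thesis
      by cases (use K'(3)[of x 0] K'(3)[of "x + h n *\<^sub>R axis j 1" "- (h n *\<^sub>R axis j 1)"] d h0[of n]
        hd[of n] in auto)
  qed
  have test: "test_function S (diff_quot j (h n) \<psi>)"
    if "\<And>k. C_k k \<psi>" "\<And>x. \<psi> x \<noteq> 0 \<Longrightarrow> x \<in> K" for \<psi> n
    by (rule test_functionI[OF C_k_diff_quot[OF that(1)] K'(1,2) sup[OF _ that(2)]])
  have lim: "(\<lambda>n. LINT x|lebesgue. diff_quot j (h n) \<psi> x * f x) \<longlonglongrightarrow> (LINT x|lebesgue. pd j \<psi> x * f x)"
    if \<psi>: "\<And>k. C_k k \<psi>" "\<And>x. \<psi> x \<noteq> 0 \<Longrightarrow> x \<in> K" and f: "locally_integrable S f" for \<psi>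
      and f :: "real^'n \<Rightarrow> real"
  proof -
    have t\<psi>: "test_function S \<psi>" by (rule test_functionI[OF \<psi>(1) K \<psi>(2)])
    have sp: "pd j \<psi> x \<noteq> 0 \<Longrightarrow> x \<in> K" for x
      by (rule pd_support[OF compact_imp_closed[OF K(1)] \<psi>(2)])
    have "C_k 0 (pd j \<psi>)" using \<psi>(1)[of 1] by simp
    then obtain C where C: "\<And>x. \<bar>pd j \<psi> x\<bar> \<le> C"
      using continuous_compact_support_bounded[OF C_k_continuous[of 0 "pd j \<psi>"] K(1) sp] by metis
    have i: "integrable lebesgue (\<lambda>x. indicator K' x * f x)"
      using f K' unfolding locally_integrable_def set_integrable_def by auto
    show ?thesis
    proof (rule integral_dominated_convergence[where w = "\<lambda>x. C * \<bar>indicator K' x * f x\<bar>"])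
      show "(\<lambda>x. pd j \<psi> x * f x) \<in> borel_measurable lebesgue"
        using borel_measurable_integrable[OF integrable_test_function[OF f test_function_pd[OF t\<psi>]]]
          by simp
      show "(\<lambda>x. diff_quot j (h n) \<psi> x * f x) \<in> borel_measurable lebesgue" for n
        using borel_measurable_integrable[OF integrable_test_function[OF f test[OF \<psi>]]] by simp
      show "integrable lebesgue (\<lambda>x. C * \<bar>indicator K' x * f x\<bar>)" using i
        by (intro integrable_mult_right integrable_abs)
      show "AE x in lebesgue. (\<lambda>n. diff_quot j (h n) \<psi> x * f x) \<longlonglongrightarrow> pd j \<psi> x * f x"
        using h0 by (intro AE_I2 tendsto_mult tendsto_const diff_quot_tendsto[OF \<psi>(1) hl]) (auto
          simp: less_le)
      show "AE x in lebesgue. norm (diff_quot j (h n) \<psi> x * f x) \<le> C * \<bar>indicator K' x * f x\<bar>" for n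
      proof (rule AE_I2)
        fix x
        show "norm (diff_quot j (h n) \<psi> x * f x) \<le> C * \<bar>indicator K' x * f x\<bar>"
        proof (cases "x \<in> K'")
          case True
          then show ?thesis using diff_quot_bounded[OF \<psi>(1) h0[of n] C, of x]
            by (simp add: abs_mult mult_right_mono)
        next
          case False
          then have "diff_quot j (h n) \<psi> x = 0" using sup[where n = n and \<psi> = \<psi> and x = x] \<psi>(2) by blast
          then show ?thesis using False by simp
        qed
      qed
    qed
  qed
  show thesis by (rule that[of h]) (use h0 test lim in \<open>auto simp: smooth_on_supp_def\<close>)
qed

lemma locally_integrable_const: "locally_integrable S (\<lambda>x. c)"
  unfolding locally_integrable_def
  by (auto intro!: absolutely_integrable_on_const lmeasurable_compact)

text \<open>The point is that the derivative of a test function has integral 0. By translation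
  invariance every difference quotient has integral 0, and this passes to the limit.\<close>

lemma has_weak_pd_const:
  fixes c :: real and S :: "(real^'n::finite) set"
  assumes S: "open S"
  shows "has_weak_pd S j (\<lambda>x. c) (\<lambda>x. 0)"
  unfolding has_weak_pd_iff
proof (intro conjI allI impI locally_integrable_const)
  fix \<phi> assume \<phi>: "test_function S \<phi>"
  obtain K where K: "\<And>k. C_k k \<phi>" "compact K" "K \<subseteq> S" "\<And>x. \<phi> x \<noteq> 0 \<Longrightarrow> x \<in> K"
    using test_functionE[OF \<phi>] by metis
  obtain h where t: "\<forall>\<psi> n. smooth_on_supp K \<psi> \<longrightarrow> test_function S (diff_quot j (h n) \<psi>)"
    and lim: "\<forall>\<psi> f. smooth_on_supp K \<psi> \<longrightarrow> locally_integrable S f \<longrightarrow>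
       (\<lambda>n. LINT x|lebesgue. diff_quot j (h n) \<psi> x * f x) \<longlonglongrightarrow> (LINT x|lebesgue. pd j \<psi> x * f x)"
    by (rule diff_quot_approx[OF S K(2,3), where j = j]) (rule that)
  have sm: "smooth_on_supp K \<phi>" using K by (simp add: smooth_on_supp_def)
  have m[measurable]: "\<phi> \<in> borel_measurable borel" using test_function_measurable[OF \<phi>] by simp
  have "integrable lebesgue \<phi>" using integrable_test_function[OF locally_integrable_const \<phi>, of
    "1::real"] by simp
  then have i: "integrable lborel \<phi>" by (simp add: integrable_completion)
  have "(LINT x|lebesgue. diff_quot j (h n) \<phi> x * c) = 0" for n
  proof -
    let ?a = "h n *\<^sub>R axis j 1 :: real^'n"
    have "integrable (distr lborel borel ((+) ?a)) \<phi>" using i by (simp add: lborel_distr_plus)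
    then have i': "integrable lborel (\<lambda>x. \<phi> (x + ?a))"
      by (subst (asm) integrable_distr_eq) (auto simp: add.commute)
    have "(LINT x|lborel. \<phi> (x + ?a) - \<phi> x) = 0"
      using i i' lborel_integral_translation[of \<phi> ?a] by simp
    moreover have "(LINT x|lebesgue. diff_quot j (h n) \<phi> x * c) =
      (LINT x|lborel. diff_quot j (h n) \<phi> x * c)"
      unfolding diff_quot_def by (rule integral_completion) measurable
    moreover have "\<dots> = (1 / h n) * (LINT x|lborel. \<phi> (x + ?a) - \<phi> x) * c"
      by (simp add: diff_quot_def)
    ultimately show ?thesis by (simp only: mult_zero_left mult_zero_right)
  qed
  then have "(\<lambda>n. 0) \<longlonglongrightarrow> (LINT x|lebesgue. pd j \<phi> x * c)"
    using lim[rule_format, OF sm locally_integrable_const[of S c]] by (simp only:)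
  then have "(LINT x|lebesgue. pd j \<phi> x * c) = 0" by (simp add: LIMSEQ_const_iff)
  then show "(LINT x|lebesgue. pd j \<phi> x *\<^sub>R c) = - (LINT x|lebesgue. \<phi> x *\<^sub>R 0)" by simp
qed

text \<open>Difference quotients commute with \<open>pd\<close> exactly, which avoids the symmetry of classical second
  derivatives of test functions.\<close>

lemma weak_mixed_pd_integral:
  fixes u :: "real^'n::finite \<Rightarrow> real"
  assumes S: "open S" and \<phi>: "test_function S \<phi>"
    and u: "has_weak_pd S j u u\<^sub>j" "has_weak_pd S k u u\<^sub>k"
    and uu: "has_weak_pd S j u\<^sub>k a" "has_weak_pd S k u\<^sub>j b"
  shows "(LINT x|lebesgue. \<phi> x * a x) = (LINT x|lebesgue. \<phi> x * b x)"
proof -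
  have loc: "locally_integrable S u" "locally_integrable S u\<^sub>k" using u unfolding has_weak_pd_def
    by blast+
  have C1: "C_k (Suc 0) \<phi>" using \<phi> by (simp add: test_function_def del: C_k.simps)
  obtain K where K: "\<And>k. C_k k \<phi>" "compact K" "K \<subseteq> S" "\<And>x. \<phi> x \<noteq> 0 \<Longrightarrow> x \<in> K"
    "\<And>j x. pd j \<phi> x \<noteq> 0 \<Longrightarrow> x \<in> K"
    using test_functionE[OF \<phi>] by metis
  have Cpd: "C_k i (pd k \<phi>)" for i using K(1)[of "Suc i"] by simp
  obtain h where t: "\<forall>\<psi> n. smooth_on_supp K \<psi> \<longrightarrow> test_function S (diff_quot j (h n) \<psi>)"
    and lim: "\<forall>\<psi> f. smooth_on_supp K \<psi> \<longrightarrow> locally_integrable S f \<longrightarrow>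
       (\<lambda>n. LINT x|lebesgue. diff_quot j (h n) \<psi> x * f x) \<longlonglongrightarrow> (LINT x|lebesgue. pd j \<psi> x * f x)"
    by (rule diff_quot_approx[OF S K(2,3), where j = j]) (rule that)
  have sm: "smooth_on_supp K \<phi>" using K by (simp add: smooth_on_supp_def)
  have smk: "smooth_on_supp K (pd k \<phi>)" using Cpd K(5) by (simp add: smooth_on_supp_def)
  \<comment> \<open>The weak equation of \<open>u\<close> in direction \<open>k\<close> is tested
    with the difference quotient of \<open>\<phi>\<close> in direction \<open>j\<close>. In the
    limit the second derivative of \<open>\<phi>\<close> appears in the order
    \<open>pd j (pd k \<phi>)\<close>, exactly the order in which the equation in direction
    \<open>j\<close> can be applied to \<open>pd k \<phi>\<close>.\<close>
  have "(LINT x|lebesgue. diff_quot j (h n) \<phi> x * u\<^sub>k x) =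
    - (LINT x|lebesgue. diff_quot j (h n) (pd k \<phi>) x * u x)" for n
    using has_weak_pdD[OF u(2) t[rule_format, OF sm, of n]] by (simp add: pd_diff_quot[OF C1])
  then have "(\<lambda>n. LINT x|lebesgue. diff_quot j (h n) \<phi> x * u\<^sub>k x) \<longlonglongrightarrow>
    - (LINT x|lebesgue. pd j (pd k \<phi>) x * u x)"
    using tendsto_minus[OF lim[rule_format, OF smk loc(1)]] by simp
  then have "(LINT x|lebesgue. pd j \<phi> x * u\<^sub>k x) = - (LINT x|lebesgue. pd j (pd k \<phi>) x * u x)"
    using LIMSEQ_unique[OF lim[rule_format, OF sm loc(2)]] by blast
  moreover have "(LINT x|lebesgue. pd j \<phi> x * u\<^sub>k x) = - (LINT x|lebesgue. \<phi> x * a x)"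
    using has_weak_pdD[OF uu(1) \<phi>] by simp
  moreover have "(LINT x|lebesgue. pd j (pd k \<phi>) x * u x) = - (LINT x|lebesgue. pd k \<phi> x * u\<^sub>j x)"
    using has_weak_pdD[OF u(1) test_function_pd[OF \<phi>]] by simp
  moreover have "(LINT x|lebesgue. pd k \<phi> x * u\<^sub>j x) = - (LINT x|lebesgue. \<phi> x * b x)"
    using has_weak_pdD[OF uu(2) \<phi>] by simp
  ultimately show ?thesis by simp
qed

subsection \<open>Calculus of weak derivatives\<close>

lemma locally_integrable_component:
  fixes f :: "real^'n::finite \<Rightarrow> real^'m::finite"
  shows "locally_integrable S f \<Longrightarrow> locally_integrable S (\<lambda>x. f x $ i)"
  unfolding locally_integrable_def
  using absolutely_integrable_linear[OF _ bounded_linear_vec_nth[of i], where f = f]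
    by (auto simp: o_def)

lemma has_weak_pd_component:
  fixes f :: "real^'n::finite \<Rightarrow> real^'m::finite"
  assumes fg: "has_weak_pd S j f g"
  shows "has_weak_pd S j (\<lambda>x. f x $ i) (\<lambda>x. g x $ i)"
proof -
  have loc: "locally_integrable S f" "locally_integrable S g" using fg unfolding has_weak_pd_iff
    by blast+
  show ?thesis unfolding has_weak_pd_iff
  proof (intro conjI allI impI locally_integrable_component loc)
    fix \<phi> assume \<phi>: "test_function S \<phi>"
    have c: "(LINT x|lebesgue. \<psi> x *\<^sub>R (u x $ i)) = (LINT x|lebesgue. \<psi> x *\<^sub>R u x) $ i"
      if "test_function S \<psi>" "locally_integrable S u" for \<psi> and u :: "real^'n \<Rightarrow> real^'m"
      using integral_bounded_linear[OF bounded_linear_vec_nth integrable_test_function[OF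
        that(2,1)], of i] by simp
    show "(LINT x|lebesgue. pd j \<phi> x *\<^sub>R (f x $ i)) = - (LINT x|lebesgue. \<phi> x *\<^sub>R (g x $ i))"
      unfolding c[OF test_function_pd[OF \<phi>] loc(1)] c[OF \<phi> loc(2)] has_weak_pdD[OF fg \<phi>] by simp
  qed
qed

lemma has_weak_pd_vec:
  fixes f :: "real^'n::finite \<Rightarrow> real^'m::finite"
  assumes fg: "\<And>i. has_weak_pd S j (\<lambda>x. f x $ i) (\<lambda>x. g x $ i)"
  shows "has_weak_pd S j f g"
proof -
  have l: "locally_integrable S u" if "\<And>i. locally_integrable S (\<lambda>x. u x $ i)"
    for u :: "real^'n \<Rightarrow> real^'m"
    unfolding locally_integrable_def
  proof (intro allI impI)
    fix K assume K: "compact K \<and> K \<subseteq> S"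
    show "u absolutely_integrable_on K"
    proof (rule absolutely_integrable_componentwise)
      fix b :: "real^'m" assume "b \<in> Basis"
      then show "(\<lambda>x. u x \<bullet> b) absolutely_integrable_on K"
        using that K by (auto simp: Basis_vec_def inner_axis locally_integrable_def)
    qed
  qed
  have loc: "locally_integrable S f" "locally_integrable S g" using fg l unfolding has_weak_pd_iff
    by blast+
  show ?thesis unfolding has_weak_pd_iff
  proof (intro conjI allI impI loc)
    fix \<phi> assume \<phi>: "test_function S \<phi>"
    have c: "(LINT x|lebesgue. \<psi> x *\<^sub>R u x) $ i = (LINT x|lebesgue. \<psi> x *\<^sub>R (u x $ i))"
      if "test_function S \<psi>" "locally_integrable S u" for \<psi> i and u :: "real^'n \<Rightarrow> real^'m"
      using integral_bounded_linear[OF bounded_linear_vec_nth integrable_test_function[OF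
        that(2,1)], of i] by simp
    show "(LINT x|lebesgue. pd j \<phi> x *\<^sub>R f x) = - (LINT x|lebesgue. \<phi> x *\<^sub>R g x)"
      unfolding vec_eq_iff vector_uminus_component c[OF test_function_pd[OF \<phi>] loc(1)] c[OF \<phi> loc(2)]
      using has_weak_pdD[OF fg \<phi>] by blast
  qed
qed

section \<open>Changes on null sets, linear operations and the product rule\<close>

lemma locally_integrable_cong_AE:
  assumes f: "locally_integrable S f" and ae: "AE x in lebesgue. x \<in> S \<longrightarrow> f x = g x"
  shows "locally_integrable S g"
proof -
  obtain N where N: "N \<in> null_sets lebesgue" "{x. \<not> (x \<in> S \<longrightarrow> f x = g x)} \<subseteq> N"
    using ae unfolding eventually_ae_filter by auto
  show ?thesis unfolding locally_integrable_def
  proof (intro allI impI)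
    fix K assume K: "compact K \<and> K \<subseteq> S"
    then have "f absolutely_integrable_on K" using f unfolding locally_integrable_def by blast
    then show "g absolutely_integrable_on K"
      by (rule absolutely_integrable_spike[where S = N]) (use N K in \<open>auto simp: negligible_iff_null_sets\<close>)
  qed
qed

lemma has_weak_pd_cong_AE:
  assumes fg: "has_weak_pd S j f g"
    and f: "AE x in lebesgue. x \<in> S \<longrightarrow> f x = f' x" and g: "AE x in lebesgue. x \<in> S \<longrightarrow> g x = g' x"
  shows "has_weak_pd S j f' g'"
proof -
  have loc: "locally_integrable S f" "locally_integrable S g" using fg unfolding has_weak_pd_iff
    by blast+
  note loc' = locally_integrable_cong_AE[OF loc(1) f] locally_integrable_cong_AE[OF loc(2) g]
  have e: "(LINT x|lebesgue. \<psi> x *\<^sub>R u x) = (LINT x|lebesgue. \<psi> x *\<^sub>R w x)"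
    if "test_function S \<psi>" "locally_integrable S u" "locally_integrable S w"
      "AE x in lebesgue. x \<in> S \<longrightarrow> u x = w x" for \<psi> u w
  proof (rule integral_cong_AE)
    have "\<psi> x \<noteq> 0 \<Longrightarrow> x \<in> S" for x using test_functionE[OF that(1)] by (metis subsetD)
    then show "AE x in lebesgue. \<psi> x *\<^sub>R u x = \<psi> x *\<^sub>R w x"
      using that(4) by (auto elim: eventually_mono)
  qed (use integrable_test_function that in \<open>blast intro: borel_measurable_integrable\<close>)+
  show ?thesis unfolding has_weak_pd_iff
  proof (intro conjI allI impI loc')
    fix \<phi> assume \<phi>: "test_function S \<phi>"
    show "(LINT x|lebesgue. pd j \<phi> x *\<^sub>R f' x) = - (LINT x|lebesgue. \<phi> x *\<^sub>R g' x)"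
      using has_weak_pdD[OF fg \<phi>] e[OF test_function_pd[OF \<phi>] loc(1) loc'(1) f]
        e[OF \<phi> loc(2) loc'(2) g] by simp
  qed
qed

lemma has_weak_pd_add:
  assumes "has_weak_pd S j f f'" "has_weak_pd S j g g'"
  shows "has_weak_pd S j (\<lambda>x. f x + g x) (\<lambda>x. f' x + g' x)"
proof -
  have loc: "locally_integrable S f" "locally_integrable S f'" "locally_integrable S g"
    "locally_integrable S g'"
    using assms unfolding has_weak_pd_iff by blast+
  show ?thesis unfolding has_weak_pd_iff
  proof (intro conjI allI impI locally_integrable_add loc)
    fix \<phi> assume \<phi>: "test_function S \<phi>"
    note i = integrable_test_function[OF _ \<phi>] integrable_test_function[OF _ test_function_pd[OF \<phi>, of j]]
    show "(LINT x|lebesgue. pd j \<phi> x *\<^sub>R (f x + g x)) = - (LINT x|lebesgue. \<phi> x *\<^sub>R (f' x + g' x))"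
      using has_weak_pdD[OF assms(1) \<phi>] has_weak_pdD[OF assms(2) \<phi>] i(2)[OF loc(1)] i(2)[OF loc(3)]
        i(1)[OF loc(2)] i(1)[OF loc(4)]
      by (simp add: scaleR_add_right)
  qed
qed

lemma has_weak_pd_minus:
  assumes "has_weak_pd S j f f'"
  shows "has_weak_pd S j (\<lambda>x. - f x) (\<lambda>x. - f' x)"
proof -
  have "locally_integrable S (\<lambda>x. - u x)" if "locally_integrable S u" for u :: "real^'a \<Rightarrow> 'b"
    using that unfolding locally_integrable_def set_integrable_def by simp
  then show ?thesis using assms unfolding has_weak_pd_iff by simp
qed

lemma has_weak_pd_mult_bounded:
  fixes u w :: "real^'n::finite \<Rightarrow> real"
  assumes S: "open S" and u: "has_weak_pd S j u u'" and w: "has_weak_pd S j w w'"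
    and C: "\<And>x. x \<in> S \<Longrightarrow> \<bar>u x\<bar> \<le> C" "\<And>x. x \<in> S \<Longrightarrow> \<bar>w x\<bar> \<le> C" "C \<ge> 0"
  shows "has_weak_pd S j (\<lambda>x. u x * w x) (\<lambda>x. u' x * w x + u x * w' x)"
proof -
  have loc: "locally_integrable S u" "locally_integrable S u'" "locally_integrable S w"
    "locally_integrable S w'"
    using u w unfolding has_weak_pd_def by blast+
  note m = locally_integrable_mult_bounded
  have l: "locally_integrable S (\<lambda>x. u x * w x)" "locally_integrable S (\<lambda>x. u' x * w x)"
    "locally_integrable S (\<lambda>x. u x * w' x)"
    using m[OF loc(1,3) C(2,3)] m[OF loc(2,3) C(2,3)] m[OF loc(4,1) C(1,3)]
      by (simp_all add: mult.commute)
  show ?thesis unfolding has_weak_pd_iff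
  proof (intro conjI allI impI l locally_integrable_add)
    fix \<phi> assume \<phi>: "test_function S \<phi>"
    show "(LINT x|lebesgue. pd j \<phi> x *\<^sub>R (u x * w x)) = - (LINT x|lebesgue. \<phi> x *\<^sub>R (u' x * w x +
      u x * w' x))"
      using weak_product_integral[OF S u w C \<phi>] integrable_test_function[OF l(2) \<phi>]
        integrable_test_function[OF l(3) \<phi>]
      by (simp add: distrib_left)
  qed
qed

text \<open>For derivatives of \<open>v\<close> the bounds hold only almost everywhere. Replacing
  values beyond \<open>C\<close> by 0 changes nothing off a null set and gives bounds at every
  point.\<close>

lemma has_weak_pd_mult:
  fixes u w :: "real^'n::finite \<Rightarrow> real"
  assumes S: "open S" and u: "has_weak_pd S j u u'" and w: "has_weak_pd S j w w'"
    and C: "AE x in lebesgue. x \<in> S \<longrightarrow> \<bar>u x\<bar> \<le> C" "AE x in lebesgue. x \<in> S \<longrightarrow> \<bar>w x\<bar> \<le> C" "C \<ge> 0"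
  shows "has_weak_pd S j (\<lambda>x. u x * w x) (\<lambda>x. u' x * w x + u x * w' x)"
proof -
  define clip :: "real \<Rightarrow> real" where "clip t = (if \<bar>t\<bar> \<le> C then t else 0)" for t
  have clip: "AE x in lebesgue. x \<in> S \<longrightarrow> u x = clip (u x)" "AE x in lebesgue. x \<in> S \<longrightarrow> w x = clip (w x)"
    using C(1,2) by (eventually_elim, simp add: clip_def)+
  have "has_weak_pd S j (\<lambda>x. clip (u x) * clip (w x)) (\<lambda>x. u' x * clip (w x) + clip (u x) * w' x)"
    by (rule has_weak_pd_mult_bounded[OF S has_weak_pd_cong_AE[OF u clip(1)]
      has_weak_pd_cong_AE[OF w clip(2)], where C = C])
      (use C(3) in \<open>auto simp: clip_def\<close>)
  then show ?thesis
  proof (rule has_weak_pd_cong_AE)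
    show "AE x in lebesgue. x \<in> S \<longrightarrow> clip (u x) * clip (w x) = u x * w x"
      using clip by eventually_elim simp
    show "AE x in lebesgue. x \<in> S \<longrightarrow> u' x * clip (w x) + clip (u x) * w' x = u' x * w x + u x * w' x"
      using clip by eventually_elim simp
  qed
qed

section \<open>Uniqueness of weak derivatives and symmetry of mixed ones\<close>

lemma has_weak_pd_unique_real:
  fixes f :: "real^'n::finite \<Rightarrow> real"
  assumes S: "open S" and g: "has_weak_pd S j f g" and h: "has_weak_pd S j f h"
  shows "AE x in lebesgue. x \<in> S \<longrightarrow> g x = h x"
proof -
  have loc: "locally_integrable S g" "locally_integrable S h" "locally_integrable S (\<lambda>x. - h x)"
    using g has_weak_pd_minus[OF h] h unfolding has_weak_pd_iff by blast+
  have "AE x in lebesgue. x \<in> S \<longrightarrow> g x + - h x = 0"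
  proof (rule fundamental_lemma[OF S locally_integrable_add[OF loc(1,3)]])
    fix \<phi> assume \<phi>: "test_function S \<phi>"
    show "(LINT x|lebesgue. \<phi> x * (g x + - h x)) = 0"
      using has_weak_pdD[OF g \<phi>] has_weak_pdD[OF h \<phi>] integrable_test_function[OF loc(1) \<phi>]
        integrable_test_function[OF loc(2) \<phi>]
      by (simp add: right_diff_distrib)
  qed
  then show ?thesis by (rule eventually_mono) auto
qed

lemma AE_vec_eqI:
  fixes g h :: "'a \<Rightarrow> real^'m::finite"
  assumes "\<And>i. AE x in M. x \<in> S \<longrightarrow> g x $ i = h x $ i"
  shows "AE x in M. x \<in> S \<longrightarrow> g x = h x"
proof -
  have "AE x in M. \<forall>i. x \<in> S \<longrightarrow> g x $ i = h x $ i" using assms by (intro eventually_all_finite)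
  then show ?thesis by (rule eventually_mono) (auto simp: vec_eq_iff)
qed

lemma has_weak_pd_unique:
  fixes f :: "real^'n::finite \<Rightarrow> real^'m::finite"
  assumes S: "open S" and g: "has_weak_pd S j f g" and h: "has_weak_pd S j f h"
  shows "AE x in lebesgue. x \<in> S \<longrightarrow> g x = h x"
  by (intro AE_vec_eqI has_weak_pd_unique_real[OF S has_weak_pd_component[OF g]
    has_weak_pd_component[OF h]])

text \<open>Equality of the integrals says that \<open>b\<close> is also a weak derivative of
  \<open>u\<^sub>k\<close> in direction \<open>j\<close>, so uniqueness identifies it with
  \<open>a\<close>.\<close>

lemma weak_mixed_pd:
  fixes u :: "real^'n::finite \<Rightarrow> real^'m::finite"
  assumes S: "open S"
    and u: "has_weak_pd S j u u\<^sub>j" "has_weak_pd S k u u\<^sub>k"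
    and uu: "has_weak_pd S j u\<^sub>k a" "has_weak_pd S k u\<^sub>j b"
  shows "AE x in lebesgue. x \<in> S \<longrightarrow> a x = b x"
proof (rule AE_vec_eqI)
  fix i
  note c = u[THEN has_weak_pd_component[where i = i]] uu[THEN has_weak_pd_component[where i = i]]
  have "has_weak_pd S j (\<lambda>x. u\<^sub>k x $ i) (\<lambda>x. b x $ i)"
    using c(3,4) weak_mixed_pd_integral[OF S _ c] unfolding has_weak_pd_iff by simp
  then show "AE x in lebesgue. x \<in> S \<longrightarrow> a x $ i = b x $ i" by (rule has_weak_pd_unique_real[OF S c(3)])
qed

section \<open>Product rules for inner and cross products\<close>

lemma has_weak_pd_sum:
  assumes S: "open S" and f: "\<And>i. i \<in> I \<Longrightarrow> has_weak_pd S j (f i) (f' i)"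
  shows "has_weak_pd S j (\<lambda>x. \<Sum>i\<in>I. f i x :: real) (\<lambda>x. \<Sum>i\<in>I. f' i x)"
  using f by (induction I rule: infinite_finite_induct) (auto intro: has_weak_pd_add
    has_weak_pd_const[OF S])

lemma AE_component_le_norm:
  fixes u :: "'a \<Rightarrow> real^'m::finite"
  assumes "AE x in M. x \<in> S \<longrightarrow> norm (u x) \<le> C"
  shows "AE x in M. x \<in> S \<longrightarrow> \<bar>u x $ i\<bar> \<le> C"
  using assms by (rule eventually_mono) (use component_le_norm_cart order_trans in blast)

lemma has_weak_pd_inner:
  fixes f g :: "real^'n::finite \<Rightarrow> real^'m::finite"
  assumes S: "open S" and f: "has_weak_pd S j f f'" and g: "has_weak_pd S j g g'"
    and C: "AE x in lebesgue. x \<in> S \<longrightarrow> norm (f x) \<le> C" "AE x in lebesgue. x \<in> S \<longrightarrow> norm (g x) \<le> C" "C \<ge> 0"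
  shows "has_weak_pd S j (\<lambda>x. f x \<bullet> g x) (\<lambda>x. f' x \<bullet> g x + f x \<bullet> g' x)"
proof -
  note b = AE_component_le_norm
  show ?thesis
    unfolding inner_vec_def inner_real_def sum.distrib[symmetric]
    by (intro has_weak_pd_sum[OF S] has_weak_pd_mult[OF S _ _ b[OF C(1)] b[OF C(2)] C(3)]
        has_weak_pd_component[OF f] has_weak_pd_component[OF g])
qed

lemma has_weak_pd_cross3:
  fixes f g :: "real^'n::finite \<Rightarrow> real^3"
  assumes S: "open S" and f: "has_weak_pd S j f f'" and g: "has_weak_pd S j g g'"
    and C: "AE x in lebesgue. x \<in> S \<longrightarrow> norm (f x) \<le> C" "AE x in lebesgue. x \<in> S \<longrightarrow> norm (g x) \<le> C" "C \<ge> 0"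
  shows "has_weak_pd S j (\<lambda>x. cross3 (f x) (g x)) (\<lambda>x. cross3 (f' x) (g x) + cross3 (f x) (g' x))"
proof -
  note b = AE_component_le_norm
  have m: "has_weak_pd S j (\<lambda>x. f x $ i * g x $ k) (\<lambda>x. f' x $ i * g x $ k + f x $ i * g' x $ k)" for i k
    by (rule has_weak_pd_mult[OF S has_weak_pd_component[OF f] has_weak_pd_component[OF g]
      b[OF C(1)] b[OF C(2)] C(3)])
  have d: "has_weak_pd S j (\<lambda>x. f x $ i * g x $ k - f x $ k * g x $ i)
     (\<lambda>x. (f' x $ i * g x $ k - f' x $ k * g x $ i) + (f x $ i * g' x $ k - f x $ k * g' x $ i))" for i k
    using has_weak_pd_add[OF m[of i k] has_weak_pd_minus[OF m[of k i]]] by (simp add: algebra_simps)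
  show ?thesis
  proof (rule has_weak_pd_vec)
    fix i :: 3
    show "has_weak_pd S j (\<lambda>x. cross3 (f x) (g x) $ i) (\<lambda>x. (cross3 (f' x) (g x) +
      cross3 (f x) (g' x)) $ i)"
      using exhaust_3[of i] d[of 2 3] d[of 3 1] d[of 1 2] by (auto simp: cross3_simps)
  qed
qed

subsection \<open>The quadratic forms\<close>

definition symmetric_form :: "('a::euclidean_space \<Rightarrow> 'a \<Rightarrow> real) \<Rightarrow> bool" where
  "symmetric_form b \<longleftrightarrow> bilinear b \<and> (\<forall>x y. b x y = b y x)"

lemma linear_coeffs_sym_part: "linear (\<lambda>A. coeffs_in G (sym_part A) $ i)"
  by (rule linearI) (auto simp: coeffs_in_def sym_part_def inner_left_distrib inner_right_distrib
     transpose_def vec_eq_iff inner_vec_def sum.distrib algebra_simps sum_distrib_left)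

lemma Q_hom_form:
  obtains b where "symmetric_form b" "\<And>A. Q_hom \<gamma> LL G s A = b A A"
proof
  let ?l = "\<lambda>i A. coeffs_in G (sym_part A) $ i"
  let ?Q = "\<lambda>i j. Q_hat \<gamma> LL G s $ i $ j"
  \<comment> \<open>Averaging the two orders makes the polar form symmetric by construction.\<close>
  let ?b = "\<lambda>A A'. \<Sum>i\<in>UNIV. \<Sum>j\<in>UNIV. ?Q i j * ((?l i A * ?l j A' + ?l i A' * ?l j A) / 2)"
  note lin = linear_coeffs_sym_part[of G]
  have "bilinear ?b" unfolding bilinear_def
    by (auto intro!: linearI simp: linear_add[OF lin] linear_scale[OF lin] sum.distrib[symmetric]
        sum_distrib_left field_simps intro!: sum.cong)
  then show "symmetric_form ?b"
    unfolding symmetric_form_def by (simp add: add.commute)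
  show "Q_hom \<gamma> LL G s A = ?b A A" for A
    by (simp add: Q_hom_def mult.assoc)
qed

lemma Q_hom_scaleR: "Q_hom \<gamma> LL G s (c *\<^sub>R A) = c\<^sup>2 * Q_hom \<gamma> LL G s A"
  by (rule Q_hom_form[of \<gamma> LL G s])
    (auto simp: symmetric_form_def bilinear_lmul bilinear_rmul power2_eq_square)

lemma linear_contract: "linear (contract a)"
  by (rule linearI) (auto simp: contract_def vec_eq_iff sum.distrib algebra_simps sum_distrib_left)

lemma contract_tensor: "contract a (tensor b A) = (a \<bullet> b) *\<^sub>R A"
  by (simp add: contract_def tensor_def vec_eq_iff inner_vec_def sum_distrib_right mult.assoc)

text \<open>The i-th slice of the tensor is \<open>a $ i\<close> times \<open>A\<close>, so
  homogeneity of degree two leaves the sum of the squares of the components of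
  \<open>a\<close>.\<close>

lemma Q3_hom_tensor: "Q3_hom \<gamma> LL G s (tensor a A) = (norm a)\<^sup>2 * Q_hom \<gamma> LL G s A"
  by (simp add: Q3_hom_def contract_tensor Q_hom_scaleR inner_axis' sum_distrib_right[symmetric]
      power2_norm_eq_inner inner_vec_def[of a a] power2_eq_square[of "a $ _"])

lemma Q3_hom_form:
  obtains b where "symmetric_form b" "\<And>A. Q3_hom \<gamma> LL G s A = b A A"
proof -
  obtain b where b: "symmetric_form b" "\<And>A. Q_hom \<gamma> LL G s A = b A A" using Q_hom_form[of \<gamma> LL G s]
    by blast
  have bb: "bilinear b" using b(1) symmetric_form_def by blast
  let ?b = "\<lambda>E F. \<Sum>i\<in>UNIV. b (contract (axis i 1) E) (contract (axis i 1) F)"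
  have "bilinear ?b" unfolding bilinear_def
    by (auto intro!: linearI simp: linear_add[OF linear_contract] linear_scale[OF linear_contract]
        bilinear_ladd[OF bb] bilinear_radd[OF bb] bilinear_lmul[OF bb] bilinear_rmul[OF bb]
        sum.distrib sum_distrib_left)
  then have "symmetric_form ?b" using b(1) unfolding symmetric_form_def by simp
  with b(2) show ?thesis by (intro that[of ?b]) (auto simp: Q3_hom_def)
qed

text \<open>Since \<open>L3_hom\<close> is given by \<open>THE\<close>, existence and uniqueness of
  the operator must be proved. Existence: the coordinates of \<open>L E\<close> are the values of
  the polar form at \<open>E\<close> and the basis vectors. Uniqueness: a vector is determined by
  its inner products.\<close>

lemma L3_hom_inner:
  "L3_hom \<gamma> LL G s E \<bullet> F
     = 1/2 * (Q3_hom \<gamma> LL G s (E + F) - Q3_hom \<gamma> LL G s E - Q3_hom \<gamma> LL G s F)"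
proof -
  obtain b where b: "symmetric_form b" "\<And>A. Q3_hom \<gamma> LL G s A = b A A"
    using Q3_hom_form[of \<gamma> LL G s] by blast
  have bb: "bilinear b" and sym: "b x y = b y x" for x y using b(1) symmetric_form_def by blast+
  have pol: "1/2 * (Q3_hom \<gamma> LL G s (E + F) - Q3_hom \<gamma> LL G s E - Q3_hom \<gamma> LL G s F) = b E F" for E F
    using sym[of E F] by (simp add: b(2) bilinear_ladd[OF bb] bilinear_radd[OF bb])
  define L where "L E = (\<Sum>k\<in>Basis. b E k *\<^sub>R k)" for E
  have L: "L E \<bullet> F = b E F" for E F
  proof -
    have "b E F = b E (\<Sum>k\<in>Basis. (F \<bullet> k) *\<^sub>R k)" by (simp add: euclidean_representation)
    also have "\<dots> = L E \<bullet> F" 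
      by (simp add: linear_sum[of "b E"] L_def inner_sum_right inner_commute[of _ F] mult.commute
           bb[unfolded bilinear_def, THEN conjunct1, rule_format] bilinear_rmul[OF bb])
    finally show ?thesis ..
  qed
  have "L3_hom \<gamma> LL G s = L"
    unfolding L3_hom_def pol
  proof (rule the_equality)
    show "\<forall>E F. L E \<bullet> F = b E F" using L by simp
    show "L' = L" if "\<forall>E F. L' E \<bullet> F = b E F" for L'
      using that L by (metis ext vector_eq_rdot)
  qed
  then show ?thesis using L pol by simp
qed

text \<open>\<open>M\<close> stands for the second fundamental form and \<open>A\<close> for the
  effective prestrain. With H equal to minus n times the transpose of M, the tensor H + n A is n
  times (A minus the transpose of M), and \<open>Q_hom\<close> ignores both the transposition and
  the overall sign. The second equation is polarisation.\<close>

lemma Q_hom_expansion: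
  assumes "norm n = 1" "H = - tensor n (transpose M)"
  shows "Q_hom \<gamma> LL G s (M - A) = Q3_hom \<gamma> LL G s (H + tensor n A)"
    and "Q3_hom \<gamma> LL G s (H + tensor n A)
           = Q3_hom \<gamma> LL G s H + 2 * (L3_hom \<gamma> LL G s H \<bullet> tensor n A) + Q_hom \<gamma> LL G s A"
proof -
  have "sym_part (M - A) = sym_part (transpose M - A)"
    by (simp add: sym_part_def transpose_def vec_eq_iff)
  then have "Q_hom \<gamma> LL G s (M - A) = Q_hom \<gamma> LL G s ((-1) *\<^sub>R (A - transpose M))"
    by (simp add: Q_hom_def)
  also have "\<dots> = Q_hom \<gamma> LL G s (A - transpose M)"
    by (subst Q_hom_scaleR) simp
  also have "\<dots> = Q3_hom \<gamma> LL G s (tensor n (A - transpose M))"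
    using assms(1) by (simp add: Q3_hom_tensor)
  also have "tensor n (A - transpose M) = H + tensor n A"
    by (simp add: assms(2) tensor_def vec_eq_iff algebra_simps)
  finally show "Q_hom \<gamma> LL G s (M - A) = Q3_hom \<gamma> LL G s (H + tensor n A)" .
  show "Q3_hom \<gamma> LL G s (H + tensor n A)
           = Q3_hom \<gamma> LL G s H + 2 * (L3_hom \<gamma> LL G s H \<bullet> tensor n A) + Q_hom \<gamma> LL G s A"
    using assms(1) by (simp add: L3_hom_inner Q3_hom_tensor field_simps)
qed

subsection \<open>The Hessian of an isometric immersion\<close>

lemma orthonormal_frame:
  fixes d1 d2 w :: "real^3"
  assumes "d1 \<bullet> d1 = 1" "d2 \<bullet> d2 = 1" "d1 \<bullet> d2 = 0"
  shows "norm (cross3 d1 d2) = 1"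
    and "w \<bullet> d1 = 0 \<Longrightarrow> w \<bullet> d2 = 0 \<Longrightarrow> w = (w \<bullet> cross3 d1 d2) *\<^sub>R cross3 d1 d2"
proof -
  let ?n = "cross3 d1 d2"
  show n: "norm ?n = 1"
    using norm_cross[of d1 d2] assms by (simp add: norm_eq_1 power2_norm_eq_inner)
  assume w: "w \<bullet> d1 = 0" "w \<bullet> d2 = 0"
  \<comment> \<open>A vector orthogonal to both tangents has zero cross product with the normal;
    expanding the double cross product then exhibits it as a multiple of the normal.\<close>
  have "cross3 w ?n = 0" using w by (simp add: Lagrange)
  then have "(?n \<bullet> ?n) *\<^sub>R w - (?n \<bullet> w) *\<^sub>R ?n = 0" using Lagrange[of ?n w ?n] by simp
  then show "w = (w \<bullet> ?n) *\<^sub>R ?n" using n by (simp add: dot_square_norm inner_commute)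
qed

text \<open>Of the two triple products one repeats \<open>d j\<close> and vanishes; in the other,
  exchanging two factors produces the sign.\<close>

lemma inner_cross3_derivative:
  fixes d w :: "2 \<Rightarrow> real^3"
  shows "d j \<bullet> (cross3 (w 1) (d 2) + cross3 (d 1) (w 2)) = - (w j \<bullet> cross3 (d 1) (d 2))"
  using exhaust_2[of j] by (auto simp: cross3_simps)

lemma AE_lebesgue_on_open:
  assumes "open S"
  shows "(AE x in lebesgue_on S. P x) \<longleftrightarrow> (AE x in lebesgue. x \<in> S \<longrightarrow> P x)"
  using assms by (subst AE_restrict_space_iff) auto

lemma has_weak_pd_weak_pd: "has_weak_pd S j f g \<Longrightarrow> has_weak_pd S j f (weak_pd S j f)"
  unfolding weak_pd_def by (rule someI[of "has_weak_pd S j f"])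

lemma H1_has_weak_pd: "H1 S f \<Longrightarrow> has_weak_pd S j f (weak_pd S j f)"
  unfolding H1_def by (blast intro: has_weak_pd_weak_pd)

lemma hess_eq_normal_II:
  fixes v :: "real^2 \<Rightarrow> real^3"
  assumes S: "open S" and v: "H2_iso S v"
  shows "AE x in lebesgue. x \<in> S \<longrightarrow> norm (normal S v x) = 1 \<and>
           hess S v x = - tensor (normal S v x) (transpose (II S v x))"
proof -
  let ?d = "\<lambda>j. weak_pd S j v"
  let ?w = "\<lambda>j k. weak_pd S j (weak_pd S k v)"
  have d: "has_weak_pd S j v (?d j)" and w: "has_weak_pd S j (?d k) (?w j k)" for j k
    using v by (auto simp: H2_iso_def H2_def intro: H1_has_weak_pd)
  have iso: "AE x in lebesgue. x \<in> S \<longrightarrow> (\<forall>k l. ?d k x \<bullet> ?d l x = (if k = l then 1 else 0))"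
  proof -
    have "AE x in lebesgue. x \<in> S \<longrightarrow> transpose (grad S v x) ** grad S v x = mat 1"
      using v unfolding H2_iso_def AE_lebesgue_on_open[OF S] by blast
    then show ?thesis
    proof (rule eventually_mono, intro impI allI)
      fix x k l assume "x \<in> S \<longrightarrow> transpose (grad S v x) ** grad S v x = mat 1" "x \<in> S"
      then have "(transpose (grad S v x) ** grad S v x) $ k $ l = mat 1 $ k $ l" by simp
      then show "?d k x \<bullet> ?d l x = (if k = l then 1 else 0)"
        by (simp add: matrix_matrix_mult_def transpose_def grad_def inner_vec_def mat_def)
    qed
  qed
  \<comment> \<open>The columns of the gradient are unit vectors almost everywhere, which supplies
    the bound required by the product rules.\<close>
  have bd: "AE x in lebesgue. x \<in> S \<longrightarrow> norm (?d k x) \<le> 1" for k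
    using iso by (rule eventually_mono) (simp add: norm_eq_sqrt_inner)
  define \<Gamma> where "\<Gamma> j k l x = ?w j k x \<bullet> ?d l x" for j k l x
  have anti: "AE x in lebesgue. x \<in> S \<longrightarrow> \<Gamma> j k l x + \<Gamma> j l k x = 0" for j k l
  proof -
    have "has_weak_pd S j (\<lambda>x. ?d k x \<bullet> ?d l x) (\<lambda>x. ?w j k x \<bullet> ?d l x + ?d k x \<bullet> ?w j l x)"
      by (rule has_weak_pd_inner[OF S w w bd bd]) simp
    \<comment> \<open>The differentiated inner product is almost everywhere a constant, so
      uniqueness forces the expression from the product rule to vanish.\<close>
    then have "has_weak_pd S j (\<lambda>x. if k = l then 1 else 0) (\<lambda>x. ?w j k x \<bullet> ?d l x + ?d k x \<bullet> ?w j l x)"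
      by (rule has_weak_pd_cong_AE) (use iso in \<open>auto elim: eventually_mono\<close>)
    from has_weak_pd_unique_real[OF S this has_weak_pd_const[OF S]]
    show ?thesis by (simp add: \<Gamma>_def inner_commute)
  qed
  have sym: "AE x in lebesgue. x \<in> S \<longrightarrow> ?w j k x = ?w k j x" for j k
    by (rule weak_mixed_pd[OF S d d w w])
  have "AE x in lebesgue. \<forall>j k l. x \<in> S \<longrightarrow> \<Gamma> j k l x + \<Gamma> j l k x = 0"
    by (intro eventually_all_finite anti)
  moreover have "AE x in lebesgue. \<forall>j k. x \<in> S \<longrightarrow> ?w j k x = ?w k j x"
    by (intro eventually_all_finite sym)
  ultimately have tang: "AE x in lebesgue. x \<in> S \<longrightarrow> (\<forall>j k l. \<Gamma> j k l x = 0)"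
  proof eventually_elim
    case (elim x)
    show ?case
    proof (intro impI allI)
      fix j k l assume "x \<in> S"
      then have a: "\<Gamma> j k l x = - \<Gamma> j l k x" and "?w j k x = ?w k j x" for j k l
        using elim by (auto simp: eq_neg_iff_add_eq_0)
      then have s: "\<Gamma> j k l x = \<Gamma> k j l x" for j k l
        unfolding \<Gamma>_def by metis
      \<comment> \<open>Alternating the two exchanges three times each leads back to the same
        indices with the sign (-1)^3.\<close>
      have "\<Gamma> j k l x = - \<Gamma> l j k x" using a[of j k l] s[of j l k] by simp
      also have "\<dots> = \<Gamma> k l j x" using a[of l j k] s[of l k j] by simp
      also have "\<dots> = - \<Gamma> j k l x" using a[of k l j] s[of k j l] by simp
      finally show "\<Gamma> j k l x = 0" by simp
    qed
  qed
  have nrm: "AE x in lebesgue. x \<in> S \<longrightarrow>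
      weak_pd S k (normal S v) x = cross3 (?w k 1 x) (?d 2 x) + cross3 (?d 1 x) (?w k 2 x)" for k
  proof -
    \<comment> \<open>The product rule exhibits one weak derivative of the normal; by uniqueness the
      representative chosen by \<open>weak_pd\<close> agrees with it almost everywhere.\<close>
    have c: "has_weak_pd S k (normal S v) (\<lambda>x. cross3 (?w k 1 x) (?d 2 x) + cross3 (?d 1 x) (?w k 2 x))"
      unfolding normal_def[abs_def] by (rule has_weak_pd_cross3[OF S w w bd bd]) simp
    from has_weak_pd_unique[OF S has_weak_pd_weak_pd[OF c] c] show ?thesis .
  qed
  have "AE x in lebesgue. \<forall>k. x \<in> S \<longrightarrow>
      weak_pd S k (normal S v) x = cross3 (?w k 1 x) (?d 2 x) + cross3 (?d 1 x) (?w k 2 x)"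
    by (intro eventually_all_finite nrm)
  with iso tang show ?thesis
  proof eventually_elim
    case (elim x)
    show ?case
    proof
      assume x: "x \<in> S"
      have f: "?d 1 x \<bullet> ?d 1 x = 1" "?d 2 x \<bullet> ?d 2 x = 1" "?d 1 x \<bullet> ?d 2 x = 0"
        using elim(1) x by auto
      have II: "II S v x $ j $ k = - (?w k j x \<bullet> normal S v x)" for j k
        using elim(3) x inner_cross3_derivative[of "\<lambda>j. ?d j x" j "\<lambda>j. ?w k j x"]
        by (simp add: II_def normal_def)
      have w': "?w j k x = (?w j k x \<bullet> normal S v x) *\<^sub>R normal S v x" for j k
        unfolding normal_def using elim(2) x orthonormal_frame(2)[OF f, of "?w j k x"]
          by (simp add: \<Gamma>_def)
      have "?w j k x $ i = (?w j k x \<bullet> normal S v x) * normal S v x $ i" for i j k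
        using arg_cong[OF w'[of j k], of "\<lambda>u. u $ i"]
          by (simp only: vector_scaleR_component real_scaleR_def)
      \<comment> \<open>Transposing \<open>II\<close> puts \<open>?w j k\<close> into position (j,
        k), and the two minus signs cancel.\<close>
      then have "hess S v x = - tensor (normal S v x) (transpose (II S v x))"
        by (simp add: vec_eq_iff hess_def tensor_def transpose_def II mult.commute)
      moreover have "norm (normal S v x) = 1" using orthonormal_frame(1)[OF f] by (simp add: normal_def)
      ultimately show "norm (normal S v x) = 1 \<and> hess S v x =
        - tensor (normal S v x) (transpose (II S v x))"
        by blast
    qed
  qed
qed

theorem lemma2p9:
  fixes S :: "(real^2) set" and v :: "real^2 \<Rightarrow> real^3" and \<gamma> c\<^sub>0 :: real
    and LL :: "(real^2) \<times> (real^3) \<Rightarrow> ((real^3^3) \<Rightarrow>\<^sub>L (real^3^3))"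
    and B :: "(real^2) \<times> (real^3) \<Rightarrow> real^3^3"
    and G :: "3 \<Rightarrow> real^2^2"
  assumes "open S" "bounded S" "connected S" "lipschitz_boundary S"
    and "\<gamma> > 0" "c\<^sub>0 > 0"
    and "LL \<in> borel_measurable (lebesgue_on (S \<times> Cell))"
    and "B \<in> borel_measurable (lebesgue_on (S \<times> Cell))"
    and "\<And>s y E F. s \<in> S \<Longrightarrow> y \<in> Cell \<Longrightarrow>
           blinfun_apply (LL (s, y)) E \<bullet> F = blinfun_apply (LL (s, y)) F \<bullet> E"
    and "\<And>s y E F. s \<in> S \<Longrightarrow> y \<in> Cell \<Longrightarrow>
           blinfun_apply (LL (s, y)) E \<bullet> F = blinfun_apply (LL (s, y)) (sym_part E) \<bullet> sym_part F"
    and "\<And>s y E F. s \<in> S \<Longrightarrow> y \<in> Cell \<Longrightarrow>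
           blinfun_apply (LL (s, y)) E \<bullet> F \<le> c\<^sub>0 * norm (sym_part E) * norm (sym_part F)"
    and "\<And>s y E. s \<in> S \<Longrightarrow> y \<in> Cell \<Longrightarrow>
           blinfun_apply (LL (s, y)) E \<bullet> E \<ge> 1 / c\<^sub>0 * (norm (sym_part E))\<^sup>2"
    and "\<And>s. s \<in> S \<Longrightarrow>
           (\<integral>\<^sup>+y\<in>Cell. ennreal ((norm (B (s, y)))\<^sup>2) \<partial>lebesgue) \<le> ennreal c\<^sub>0"
    and "orthonormal_basis_sym G"
    and "H2_iso S v"
  shows "AE s in lebesgue_on S.
           Q_hom \<gamma> LL G s (II S v s - B_eff \<gamma> LL B G s)
             = Q3_hom \<gamma> LL G s (hess S v s + tensor (normal S v s) (B_eff \<gamma> LL B G s)) \<and>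
           Q3_hom \<gamma> LL G s (hess S v s + tensor (normal S v s) (B_eff \<gamma> LL B G s))
             = Q3_hom \<gamma> LL G s (hess S v s)
               + 2 * (L3_hom \<gamma> LL G s (hess S v s) \<bullet> tensor (normal S v s) (B_eff \<gamma> LL B G s))
               + Q_hom \<gamma> LL G s (B_eff \<gamma> LL B G s)"
  unfolding AE_lebesgue_on_open[OF \<open>open S\<close>]
  using hess_eq_normal_II[OF \<open>open S\<close> \<open>H2_iso S v\<close>]
  by (rule eventually_mono) (blast intro: Q_hom_expansion)

end
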